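(* Let $P(t)\in\mathbb{DH}[t]$ be a monic motion polynomial of degree $n>0$. Then $P(t)=Q(t)\cdot R(t)$, where $Q(t)$ is a $\Delta$-free motion polynomial of degree $q\le n$ and $R(t)$ is a $\Delta$-covered motion polynomial, with the following properties. The polynomial $Q(t)$ admits at least $1$ and at most $q!$ factorizations of the form $$Q(t)=(t-h^{(1)})\cdot(t-h^{(2)})\cdot\ldots\cdot(t-h^{(q)})\quad\text{with } h^{(1)},\ldots,h^{(q)}\in(\mathbb{R}+\epsilon\,\mathrm{Im}(\mathbb{H}))\cup Q_{\mathbb{DH}},$$ each corresponding to exactly one factorization $\mathrm{primal}(Q)(t)=(t-h^{(1)}_1)\cdot(t-h^{(2)}_1)\cdot\ldots\cdot(t-h^{(q)}_1)$ of its primal part. The polynomial $R(t)$ admits either infinitely many or no factorization of the form $$R(t)=(t-h^{(q+1)})\cdot(t-h^{(q+2)})\cdot\ldots\cdot(t-h^{(n)})\quad\text{with } h^{(q+1)},\ldots,h^{(n)}\in(\mathbb{R}+\epsilon\,\mathrm{Im}(\mathbb{H}))\cup Q_{\mathbb{DH}}.$$ If it does admit such a factorization, then $\Delta_{h^{(\ell)}_1}(t)\,|\,\mathrm{primal}(R)(t)$ for all $\ell\in\{q+1,q+2,\ldots,n\}$.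
   Context: $\mathbb{H}$ is the algebra of quaternions, with conjugation $q\mapsto q^c$; $\mathrm{Im}(\mathbb{H})$ is the space of purely imaginary quaternions. The dual quaternions are $\mathbb{DH}=\mathbb{H}+\epsilon\mathbb{H}$, with elements $h=h_1+\epsilon h_2$, componentwise addition and product $hh'=h_1h'_1+\epsilon(h_1h'_2+h_2h'_1)$; $\pi(h)=h_1$ is the primal part (so $h^{(\ell)}_1$ is the primal part of $h^{(\ell)}$). Put $h^c=h_1^c+\epsilon h_2^c$, $t(h)=h+h^c$, $n(h)=hh^c$. Let $\mathbb{S}_{\mathbb{DH}}=\{J\in\mathbb{DH}: t(J)=0,\ n(J)=1\}$ and $Q_{\mathbb{DH}}=\{\alpha+\beta J:\alpha,\beta\in\mathbb{R},\ J\in\mathbb{S}_{\mathbb{DH}}\}$. $\mathbb{DH}[t]$ is the *-algebra of polynomials $\sum t^na_n$ with $a_n\in\mathbb{DH}$, where the indeterminate $t$ commutes with the coefficients: $\sum t^na_n\cdot\sum t^nb_n=\sum t^n\sum_{\ell=0}^na_\ell b_{n-\ell}$ and $(\sum t^na_n)^c=\sum t^na_n^c$. Evaluation at $h$ is $P(h)=\sum h^na_n$, and a zero of $P$ is a point $h$ with $P(h)=0$. $\mathbb{H}[t]\subset\mathbb{DH}[t]$ is the subalgebra of quaternionic polynomials, and $\mathrm{primal}(\sum t^na_n)=\sum t^n\pi(a_n)\in\mathbb{H}[t]$. $A(t)\,|\,B(t)$ means $B=A\cdot C$ for some polynomial $C$ in the same algebra. The norm of $P$ is $N(P)(t)=P(t)\cdot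 P^c(t)$. $P(t)$ is a motion polynomial if $N(P)(t)\in\mathbb{R}[t]$ and the leading coefficient of $P$ is invertible in $\mathbb{DH}$ (i.e. has nonzero primal part). For $y\in\mathbb{DH}$ put $\Delta_y(t)=(t-y)\cdot(t-y^c)=t^2-t\,t(y)+n(y)$. A motion polynomial $P(t)$ is $\Delta$-free if $\Delta_y(t)$ does not divide $\mathrm{primal}(P)(t)$ for any $y\in(\mathbb{R}+\epsilon\,\mathrm{Im}(\mathbb{H}))\cup Q_{\mathbb{DH}}$ (equivalently, for any $y\in\mathbb{H}$). A motion polynomial $P(t)$ is $\Delta$-covered if $\Delta_{y_1}(t)\,|\,\mathrm{primal}(P)(t)$ for each zero $y_1\in\mathbb{H}$ of $\mathrm{primal}(P)(t)$.
   Formalization: The claim that R admits either infinitely many or no factorization is stated only for q < n; when q = n one has R = 1, whose only factorization is the empty product, so the claim fails there (e.g. P = t − i). *)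

theory Defs
  imports Complex_Main "HOL-Library.Poly_Mapping"
begin

class star_ring = ring_1 +
  fixes star :: "'a \<Rightarrow> 'a"
  assumes star_star [simp]: "star (star x) = x"
    and star_add: "star (x + y) = star x + star y"
    and star_mult: "star (x * y) = star y * star x"

section \<open>Quaternions\<close>

datatype quat = Quat (Q0: real) (Q1: real) (Q2: real) (Q3: real)

instantiation quat :: real_algebra_1
begin

definition "0 = Quat 0 0 0 0"
definition "1 = Quat 1 0 0 0"
definition "x + y = Quat (Q0 x + Q0 y) (Q1 x + Q1 y) (Q2 x + Q2 y) (Q3 x + Q3 y)"
definition "- x = Quat (- Q0 x) (- Q1 x) (- Q2 x) (- Q3 x)"
definition "x - y = Quat (Q0 x - Q0 y) (Q1 x - Q1 y) (Q2 x - Q2 y) (Q3 x - Q3 y)"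
definition "r *\<^sub>R x = Quat (r * Q0 x) (r * Q1 x) (r * Q2 x) (r * Q3 x)"
definition "x * y = Quat
  (Q0 x * Q0 y - Q1 x * Q1 y - Q2 x * Q2 y - Q3 x * Q3 y)
  (Q0 x * Q1 y + Q1 x * Q0 y + Q2 x * Q3 y - Q3 x * Q2 y)
  (Q0 x * Q2 y - Q1 x * Q3 y + Q2 x * Q0 y + Q3 x * Q1 y)
  (Q0 x * Q3 y + Q1 x * Q2 y - Q2 x * Q1 y + Q3 x * Q0 y)"

lemmas quat_defs = zero_quat_def one_quat_def plus_quat_def uminus_quat_def minus_quat_def
  scaleR_quat_def times_quat_def

instance
  by standard (simp_all add: quat_defs algebra_simps)

end

instantiation quat :: star_ring
begin

definition "star x = Quat (Q0 x) (- Q1 x) (- Q2 x) (- Q3 x)"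

instance
  by standard (simp_all add: star_quat_def quat_defs algebra_simps)

end

definition Im_quat :: "quat set" where
  "Im_quat = {q. Q0 q = 0}"

section \<open>Dual quaternions\<close>

text \<open>\<open>DQuat a b\<close> stands for \<open>a + \<epsilon> b\<close>.\<close>

datatype dquat = DQuat (primal: quat) (dual: quat)

instantiation dquat :: real_algebra_1
begin

definition "0 = DQuat 0 0"
definition "1 = DQuat 1 0"
definition "x + y = DQuat (primal x + primal y) (dual x + dual y)"
definition "- x = DQuat (- primal x) (- dual x)"
definition "x - y = DQuat (primal x - primal y) (dual x - dual y)"
definition "r *\<^sub>R x = DQuat (r *\<^sub>R primal x) (r *\<^sub>R dual x)"
definition "x * y = DQuat (primal x * primal y) (primal x * dual y + dual x * primal y)"

lemmas dquat_defs = zero_dquat_def one_dquat_def plus_dquat_def uminus_dquat_def minus_dquat_def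
  scaleR_dquat_def times_dquat_def

instance
  by standard (simp_all add: dquat_defs dquat.expand algebra_simps)

end

instantiation dquat :: star_ring
begin

definition "star x = DQuat (star (primal x)) (star (dual x))"

instance
  by standard (simp_all add: star_dquat_def dquat_defs star_add star_mult algebra_simps)

end

definition S_DH :: "dquat set" where
  "S_DH = {J. J + star J = 0 \<and> J * star J = 1}"

definition Q_DH :: "dquat set" where
  "Q_DH = {of_real \<alpha> + \<beta> *\<^sub>R J | \<alpha> \<beta> J. J \<in> S_DH}"

definition R_eps_Im :: "dquat set" where
  "R_eps_Im = {DQuat (of_real r) v | r v. v \<in> Im_quat}"

section \<open>Polynomials with central indeterminate over a noncommutative ring\<close>

text \<open>
  The type \<open>'a poly\<close> is a ring only for commutative \<open>'a\<close>, so polynomials are rendered as the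
  monoid algebra of \<open>nat\<close>; its product is the required convolution, see \<open>lookup_npoly_mult\<close>.
  This type has the class of \<open>dvd\<close> only for commutative \<open>'a\<close>, hence the relation \<open>ldvd\<close>.
\<close>

type_synonym 'a npoly = "nat \<Rightarrow>\<^sub>0 'a"

lemma lookup_npoly_mult:
  fixes p q :: "('a::ring_1) npoly"
  shows "Poly_Mapping.lookup (p * q) n = (\<Sum>l\<le>n. Poly_Mapping.lookup p l * Poly_Mapping.lookup q (n - l))"
proof -
  have inner: "(\<Sum>k. Poly_Mapping.lookup q k when n = l + k) = (Poly_Mapping.lookup q (n - l) when l \<le> n)" for l
  proof (cases "l \<le> n")
    case True
    then have "(\<lambda>k. Poly_Mapping.lookup q k when n = l + k) = (\<lambda>k. Poly_Mapping.lookup q k when k = n - l)"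
      by (auto simp: fun_eq_iff when_def)
    then show ?thesis by (simp only: True) simp
  next
    case False
    then have "(\<lambda>k. Poly_Mapping.lookup q k when n = l + k) = (\<lambda>k. 0)"
      by (auto simp: fun_eq_iff when_def)
    then show ?thesis by (simp only: False) simp
  qed
  have "Poly_Mapping.lookup (p * q) n = (\<Sum>l. Poly_Mapping.lookup p l * (Poly_Mapping.lookup q (n - l) when l \<le> n))"
    by (simp add: lookup_mult inner)
  also have "\<dots> = (\<Sum>l\<in>{..n}. Poly_Mapping.lookup p l * (Poly_Mapping.lookup q (n - l) when l \<le> n))"
    by (rule Sum_any.expand_superset) (auto simp: when_def split: if_splits)
  finally show ?thesis by simp
qed

text \<open>\<open>Poly_Mapping.degree\<close> is larger by one than the usual degree on nonzero polynomials.\<close>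

definition deg :: "('a::zero) npoly \<Rightarrow> nat" where
  "deg p = Max (insert 0 (Poly_Mapping.keys p))"

definition leading :: "('a::zero) npoly \<Rightarrow> 'a" where
  "leading p = Poly_Mapping.lookup p (deg p)"

definition eval_at :: "('a::ring_1) npoly \<Rightarrow> 'a \<Rightarrow> 'a" where
  "eval_at p h = (\<Sum>n\<in>Poly_Mapping.keys p. h ^ n * Poly_Mapping.lookup p n)"

definition lin :: "'a::ring_1 \<Rightarrow> 'a npoly" where
  "lin h = Poly_Mapping.single 1 1 - Poly_Mapping.single 0 h"

definition ldvd :: "'a::times \<Rightarrow> 'a \<Rightarrow> bool" (infix "ldvd" 50) where
  "A ldvd B \<longleftrightarrow> (\<exists>C. B = A * C)"

definition poly_star :: "('a::star_ring) npoly \<Rightarrow> 'a npoly" where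
  "poly_star p = Poly_Mapping.map star p"

definition poly_norm :: "('a::star_ring) npoly \<Rightarrow> 'a npoly" where
  "poly_norm p = p * poly_star p"

definition Delta :: "'a::star_ring \<Rightarrow> 'a npoly" where
  "Delta y = lin y * lin (star y)"

definition poly_primal :: "dquat npoly \<Rightarrow> quat npoly" where
  "poly_primal p = Poly_Mapping.map primal p"

definition embed :: "quat npoly \<Rightarrow> dquat npoly" where
  "embed p = Poly_Mapping.map (\<lambda>a. DQuat a 0) p"

section \<open>Motion polynomials\<close>

definition motion_poly :: "dquat npoly \<Rightarrow> bool" where
  "motion_poly P \<longleftrightarrow>
    (\<forall>k. Poly_Mapping.lookup (poly_norm P) k \<in> \<real>) \<and>
    (\<exists>u. leading P * u = 1 \<and> u * leading P = 1)"

definition Delta_free :: "dquat npoly \<Rightarrow> bool" where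
  "Delta_free P \<longleftrightarrow> (\<forall>y \<in> R_eps_Im \<union> Q_DH. \<not> Delta y ldvd embed (poly_primal P))"

definition Delta_covered :: "dquat npoly \<Rightarrow> bool" where
  "Delta_covered P \<longleftrightarrow>
    (\<forall>y::quat. eval_at (poly_primal P) y = 0 \<longrightarrow> Delta y ldvd poly_primal P)"

text \<open>Factorizations are ordered: two of them are equal iff they agree factor by factor.\<close>

definition lin_factorizations :: "('a::ring_1) set \<Rightarrow> nat \<Rightarrow> 'a npoly \<Rightarrow> 'a list set" where
  "lin_factorizations S m P =
    {hs. length hs = m \<and> set hs \<subseteq> S \<and> P = prod_list (map lin hs)}"

end

theory Submission
  imports Defs
begin

text \<open>
  Write \<open>P = p + \<epsilon> d\<close>; for monic \<open>P\<close>, being a motion polynomial means \<open>p d\<^sup>c + d p\<^sup>c = 0\<close>. If \<open>p(y) = 0\<close> and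
  \<open>\<Delta>\<^sub>y\<close> does not divide \<open>p\<close>, then \<open>p \<equiv> (t - y) c\<close> modulo \<open>\<Delta>\<^sub>y\<close> with \<open>c \<noteq> 0\<close>, and comparing
  remainders in the motion equation shows that exactly one \<open>h = y + \<epsilon> v\<close> with \<open>t - h\<close> a motion
  polynomial gives a left factor \<open>t - h\<close> of \<open>P\<close>, namely \<open>v = - d(y) c\<inverse>\<close>. Splitting off such
  factors as long as possible yields \<open>Q\<close> and leaves the \<open>\<Delta>\<close>-covered \<open>R\<close>. For \<open>Q\<close>, existence and
  uniqueness of \<open>h\<close> lift factorizations of the primal part, and the primal part has at most one
  zero in each of at most \<open>q\<close> similarity classes, whence the bound \<open>q!\<close>. A factorization of \<open>R\<close>
  can be rearranged so that two adjacent factors have conjugate primal parts \<open>y\<close> and \<open>y\<^sup>c\<close>; then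
  dual parts can be shifted between them in infinitely many ways.
\<close>

section \<open>Polynomials over a noncommutative ring\<close>

abbreviation (input) coeff where "coeff \<equiv> Poly_Mapping.lookup"
abbreviation (input) cst :: "'a::zero \<Rightarrow> 'a npoly" where "cst c \<equiv> Poly_Mapping.single 0 c"
abbreviation (input) indet :: "'a::ring_1 npoly" where "indet \<equiv> Poly_Mapping.single (Suc 0) 1"

lemma lookup_map_zero: "f 0 = 0 \<Longrightarrow> coeff (Poly_Mapping.map f p) k = f (coeff p k)"
  by (simp add: Poly_Mapping.map.rep_eq when_def)

lemma coeff_single_mult:
  fixes p :: "('a::ring_1) npoly"
  shows "coeff (Poly_Mapping.single k c * p) n = (if k \<le> n then c * coeff p (n - k) else 0)"
proof -
  have "coeff (Poly_Mapping.single k c * p) n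
      = (\<Sum>l\<le>n. if l = k then c * coeff p (n - k) else 0)"
    unfolding lookup_npoly_mult by (rule sum.cong) (auto simp: lookup_single when_def)
  then show ?thesis by simp
qed

lemma coeff_mult_single:
  fixes p :: "('a::ring_1) npoly"
  shows "coeff (p * Poly_Mapping.single k c) n = (if k \<le> n then coeff p (n - k) * c else 0)"
proof -
  have "coeff (p * Poly_Mapping.single k c) n
      = (\<Sum>l\<le>n. if l = n - k then (if k \<le> n then coeff p (n - k) * c else 0) else 0)"
    unfolding lookup_npoly_mult by (rule sum.cong) (auto simp: lookup_single when_def)
  then show ?thesis by simp
qed

lemma indet_commute: "indet * p = p * indet"
  by (rule poly_mapping_eqI) (simp add: coeff_single_mult coeff_mult_single)

lemma indet_commute_left: "p * (indet * q) = indet * (p * q)"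
  by (metis indet_commute mult.assoc)

lemma lin_eq: "lin y = indet - cst y"
  by (simp add: lin_def)

section \<open>Left division by a linear polynomial\<close>

lemma coeff_lin_mult:
  "coeff (lin y * p) 0 = - y * coeff p 0"
  "coeff (lin y * p) (Suc n) = coeff p n - y * coeff p (Suc n)"
  by (simp_all add: lin_eq left_diff_distrib lookup_minus coeff_single_mult)

lemma npoly_bounded:
  fixes p :: "'a::zero npoly"
  obtains N where "\<And>n. n \<ge> N \<Longrightarrow> coeff p n = 0"
proof
  fix n assume "n \<ge> Suc (Max (insert 0 (Poly_Mapping.keys p)))"
  then have "n \<notin> Poly_Mapping.keys p"
    by (metis Max_ge finite_insert finite_keys insertCI not_less_eq_eq)
  then show "coeff p n = 0" by (simp add: in_keys_iff)
qed

text \<open>Above the constant term the coefficients satisfy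
  \<open>coeff g n = y * coeff g (Suc n)\<close>, so the vanishing of the high ones propagates
  downwards. This gives both left cancellation of \<open>lin y\<close> and uniqueness of remainders,
  over any coefficient ring.\<close>

lemma lin_mult_eq_cst:
  assumes "lin y * g = cst (c::'a::ring_1)"
  shows "g = 0" "c = 0"
proof -
  have rec: "coeff g n = y * coeff g (Suc n)" for n
    using arg_cong[OF assms, of "\<lambda>p. coeff p (Suc n)"]
    by (simp add: coeff_lin_mult lookup_single)
  obtain N where N: "\<And>n. n \<ge> N \<Longrightarrow> coeff g n = 0" using npoly_bounded by blast
  have "coeff g (N - k) = 0" for k
  proof (induction k)
    case (Suc k)
    show ?case
    proof (cases "k < N")
      case True
      then show ?thesis using rec[of "N - Suc k"] Suc by (simp add: Suc_diff_Suc)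
    qed (use Suc in simp)
  qed (use N in simp)
  then have "coeff g n = 0" for n
    by (metis N diff_diff_cancel nat_le_linear)
  then show "g = 0" by (intro poly_mapping_eqI) simp
  with assms show "c = 0" by (metis lookup_single_eq lookup_zero mult_zero_right)
qed

lemma lin_mult_cancel: "lin y * a = lin y * b \<longleftrightarrow> a = (b :: 'a::ring_1 npoly)"
  using lin_mult_eq_cst(1)[of y "a - b" 0] by (auto simp: right_diff_distrib)

lemma lin_nonzero [simp]: "lin y \<noteq> 0"
  using lin_mult_cancel[of y 1 0] by auto

text \<open>As \<open>lin y\<close> is monic, division works over every ring. By additivity
  monomials suffice, and multiplying by the central indeterminate turns quotient \<open>g\<close>
  and remainder \<open>c\<close> into \<open>indet * g + cst c\<close> and
  \<open>y * c\<close>.\<close>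

lemma lin_division:
  fixes p :: "'a::ring_1 npoly"
  obtains g c where "p = lin y * g + cst c"
proof -
  have single: "\<exists>g c. Poly_Mapping.single n a = lin y * g + cst c" for n and a :: 'a
  proof (induction n)
    case 0
    show ?case by (intro exI[of _ 0] exI[of _ a]) simp
  next
    case (Suc n)
    then obtain g c where gc: "Poly_Mapping.single n a = lin y * g + cst c" by blast
    have "Poly_Mapping.single (Suc n) a = indet * Poly_Mapping.single n a"
      by (simp add: mult_single)
    also have "\<dots> = lin y * (indet * g + cst c) + cst (y * c)"
      by (simp add: gc distrib_left indet_commute_left) (simp add: lin_eq algebra_simps mult_single indet_commute_left)
    finally show ?case by blast
  qed
  have "\<exists>g c. p = lin y * g + cst c"
  proof (induction p rule: update_induct)
    case const
    show ?case by (intro exI[of _ 0]) simp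
  next
    case (update f k v)
    from update.IH obtain a b where "f = lin y * a + cst b" by blast
    moreover obtain c d where "Poly_Mapping.single k v = lin y * c + cst d" using single by blast
    moreover have "Poly_Mapping.update k v f = f + Poly_Mapping.single k v"
      using update.hyps(1)
      by (intro poly_mapping_eqI)
        (auto simp: lookup_update lookup_add lookup_single in_keys_iff when_def)
    ultimately have "Poly_Mapping.update k v f = lin y * (a + c) + cst (b + d)"
      by (simp add: distrib_left single_add)
    then show ?case by blast
  qed
  then show thesis using that by blast
qed

section \<open>Evaluation at a point and left linear factors\<close>

lemma eval_at_Sum_any: "eval_at p h = Sum_any (\<lambda>n. h ^ n * coeff p n)"
  unfolding eval_at_def
  by (rule Sum_any.expand_superset[symmetric]) (auto simp: in_keys_iff intro: ccontr)

lemma finite_coeff: "finite {n. f n * coeff p n \<noteq> (0::'a::ring_1)}"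
  by (rule finite_subset[OF _ finite_keys[of p]]) (auto simp: in_keys_iff)

lemma eval_at_add: "eval_at (p + q) h = eval_at p h + eval_at q h"
  unfolding eval_at_Sum_any lookup_add distrib_left by (rule Sum_any.distrib[OF finite_coeff finite_coeff])

lemma eval_at_cst: "eval_at (cst c) h = c"
  by (cases "c = 0") (auto simp: eval_at_def)

text \<open>Powers stand to the left of the coefficients, so the sum telescopes without any
  commutativity.\<close>

lemma eval_at_lin_mult: "eval_at (lin y * p) y = 0"
proof -
  obtain N where N: "\<And>n. n \<ge> N \<Longrightarrow> coeff p n = 0" using npoly_bounded by blast
  have "eval_at (lin y * p) y = (\<Sum>n\<le>N. y ^ n * coeff (lin y * p) n)"
    unfolding eval_at_Sum_any
  proof (rule Sum_any.expand_superset)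
    show "{n. y ^ n * coeff (lin y * p) n \<noteq> 0} \<subseteq> {..N}"
    proof (rule subsetI, rule ccontr)
      fix n assume "n \<in> {n. y ^ n * coeff (lin y * p) n \<noteq> 0}" "n \<notin> {..N}"
      then show False using N by (cases n) (auto simp: coeff_lin_mult)
    qed
  qed simp
  also have "\<dots> = - (y ^ Suc N * coeff p N)"
  proof -
    have "(\<Sum>n\<le>K. y ^ n * coeff (lin y * p) n) = - (y ^ Suc K * coeff p K)" for K
    proof (induction K)
      case (Suc K)
      have "y ^ Suc K * y = y ^ Suc (Suc K)" by (simp only: power_Suc2)
      then show ?case
        by (simp add: Suc coeff_lin_mult right_diff_distrib del: power_Suc flip: mult.assoc)
    qed (simp add: coeff_lin_mult)
    then show ?thesis .
  qed
  finally show ?thesis using N by simp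
qed

lemma eval_at_eq_0_iff: "eval_at p y = 0 \<longleftrightarrow> lin y ldvd (p :: 'a::ring_1 npoly)"
proof
  assume *: "eval_at p y = 0"
  obtain g c where "p = lin y * g + cst c" using lin_division by blast
  with * show "lin y ldvd p" unfolding ldvd_def
    by (metis add.right_neutral add_0 eval_at_add eval_at_cst eval_at_lin_mult single_zero)
qed (auto simp: ldvd_def eval_at_lin_mult)

lemma ldvd_mult_right: "a ldvd b \<Longrightarrow> a ldvd (b * c :: 'a::ring_1)"
  by (auto simp: ldvd_def mult.assoc)

lemma ldvd_diff: "a ldvd b \<Longrightarrow> a ldvd c \<Longrightarrow> a ldvd (b - c :: 'a::ring_1)"
  unfolding ldvd_def by (metis right_diff_distrib)

lemma ldvd_self_mult: "a ldvd (a * c :: 'a::ring_1)"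
  by (auto simp: ldvd_def)

section \<open>Degrees and leading coefficients\<close>

lemma deg_eqI:
  assumes "coeff p n \<noteq> 0" "\<And>k. k > n \<Longrightarrow> coeff p k = 0"
  shows "deg p = n"
  unfolding deg_def
proof (rule Max_eqI)
  fix k assume "k \<in> insert 0 (Poly_Mapping.keys p)"
  then show "k \<le> n" using assms(2)[of k] by (auto simp: in_keys_iff not_less[symmetric])
qed (use assms in \<open>auto simp: in_keys_iff\<close>)

lemma coeff_gt_deg: "k > deg p \<Longrightarrow> coeff p k = 0"
  unfolding deg_def by (metis Max_ge finite_insert finite_keys in_keys_iff insertCI not_le)

lemma leading_nonzero: "p \<noteq> 0 \<Longrightarrow> leading p \<noteq> 0"
proof -
  assume "p \<noteq> 0"
  then have *: "Poly_Mapping.keys p \<noteq> {}" by simp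
  then have "deg p \<in> Poly_Mapping.keys p"
    unfolding deg_def by simp
  then show ?thesis by (simp add: leading_def in_keys_iff)
qed

text \<open>The top coefficient of the product is that of \<open>p\<close> because
  \<open>lin h\<close> is monic; zero divisors, as in the dual quaternions, do no harm.\<close>

lemma
  assumes "p \<noteq> 0"
  shows deg_lin_mult: "deg (lin h * p) = Suc (deg p)"
    and leading_lin_mult: "leading (lin h * p) = leading (p :: 'a::ring_1 npoly)"
proof -
  have c: "coeff (lin h * p) (Suc (deg p)) = leading p"
    by (simp add: coeff_lin_mult leading_def coeff_gt_deg)
  show d: "deg (lin h * p) = Suc (deg p)"
  proof (rule deg_eqI)
    fix k assume "k > Suc (deg p)"
    then show "coeff (lin h * p) k = 0"
      by (cases k) (auto simp: coeff_lin_mult coeff_gt_deg)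
  qed (simp add: c leading_nonzero[OF assms])
  show "leading (lin h * p) = leading p"
    unfolding leading_def[of "lin h * p"] d c ..
qed

lemma deg_leading_one: "deg (1 :: 'a::ring_1 npoly) = 0" "leading (1 :: 'a::ring_1 npoly) = 1"
proof -
  show "deg (1 :: 'a::ring_1 npoly) = 0"
    by (rule deg_eqI) (simp_all add: lookup_one)
  then show "leading (1 :: 'a::ring_1 npoly) = 1" by (simp add: leading_def lookup_one)
qed

lemma monic_nonzero: "leading p = (1 :: 'a::ring_1) \<Longrightarrow> p \<noteq> 0"
  by (auto simp: leading_def)

lemma monic_prod_lin:
  assumes "leading R = (1 :: 'a::ring_1)"
  shows "leading (prod_list (map lin hs) * R) = 1"
    and "deg (prod_list (map lin hs) * R) = length hs + deg R"
proof -
  have "leading (prod_list (map lin hs) * R) = 1 \<and> deg (prod_list (map lin hs) * R) = length hs + deg R"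
    by (induction hs) (simp_all add: assms mult.assoc deg_lin_mult leading_lin_mult monic_nonzero)
  then show "leading (prod_list (map lin hs) * R) = 1"
    "deg (prod_list (map lin hs) * R) = length hs + deg R" by simp_all
qed

lemma monic_lin_mult_iff:
  assumes "leading (lin h * R) = (1 :: 'a::ring_1)"
  shows "leading R = 1" "deg (lin h * R) = Suc (deg R)"
proof -
  have "R \<noteq> 0" using monic_nonzero[OF assms] by auto
  then show "leading R = 1" "deg (lin h * R) = Suc (deg R)"
    using assms by (simp_all add: leading_lin_mult deg_lin_mult)
qed

lemma monic_deg_0: "leading p = (1 :: 'a::ring_1) \<Longrightarrow> deg p = 0 \<Longrightarrow> p = 1"
  by (rule poly_mapping_eqI) (metis coeff_gt_deg leading_def lookup_one not_gr_zero when_def)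

lemma monic_deg_1:
  assumes "leading p = (1 :: 'a::ring_1)" "deg p = 1"
  shows "p = lin (- coeff p 0)"
proof (rule poly_mapping_eqI)
  fix n :: nat
  consider "n = 0" | "n = 1" | "n > 1" by linarith
  then show "coeff p n = coeff (lin (- coeff p 0)) n"
    using assms by cases (auto simp: lin_def lookup_minus lookup_single leading_def coeff_gt_deg)
qed

section \<open>Polynomials with an involution\<close>

lemma star_zero [simp]: "star 0 = (0 :: 'a::star_ring)"
  using star_add[of 0 0] by simp

lemma star_minus: "star (- x) = - star (x :: 'a::star_ring)"
  using star_add[of x "- x"] by (simp add: eq_neg_iff_add_eq_0 add.commute)

lemma star_diff: "star (x - y) = star x - star (y :: 'a::star_ring)"
  using star_add[of x "- y"] by (simp add: star_minus)

lemma star_one [simp]: "star 1 = (1 :: 'a::star_ring)"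
  by (metis mult_1_right star_mult star_star)

lemma star_sum: "star (sum f A) = (\<Sum>a\<in>A. star (f a :: 'a::star_ring))"
  by (induction A rule: infinite_finite_induct) (simp_all add: star_add)

lemma coeff_poly_star [simp]: "coeff (poly_star p) n = star (coeff p n)"
  by (simp add: poly_star_def lookup_map_zero)

lemma poly_star_add: "poly_star (p + q) = poly_star p + poly_star q"
  and poly_star_diff: "poly_star (p - q) = poly_star p - poly_star q"
  and poly_star_minus: "poly_star (- p) = - poly_star p"
  and poly_star_star [simp]: "poly_star (poly_star p) = p"
  and poly_star_cst [simp]: "poly_star (cst c) = cst (star c)"
  by (auto intro!: poly_mapping_eqI simp: lookup_add lookup_minus star_add star_diff star_minus lookup_single when_def)

lemma poly_star_mult: "poly_star (p * q) = poly_star q * poly_star p"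
proof (rule poly_mapping_eqI)
  fix n
  show "coeff (poly_star (p * q)) n = coeff (poly_star q * poly_star p) n"
    unfolding coeff_poly_star lookup_npoly_mult star_sum star_mult
    by (rule sum.reindex_bij_witness[of _ "\<lambda>l. n - l" "\<lambda>l. n - l"]) auto
qed

lemma poly_star_lin [simp]: "poly_star (lin y) = lin (star y)"
  by (rule poly_mapping_eqI) (simp add: lin_def lookup_minus lookup_single when_def star_diff)

lemma poly_star_Delta [simp]: "poly_star (Delta y) = Delta y"
  by (simp add: Delta_def poly_star_mult)

text \<open>The remainder measures how far \<open>v\<close> is from intertwining \<open>y\<close>
  and \<open>z\<close>; it vanishes when \<open>z * v = v * y\<close>.\<close>

lemma cst_lin: "cst v * lin y = lin z * cst v + cst (z * v - v * y :: 'a::ring_1)"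
  by (simp add: lin_eq algebra_simps mult_single single_diff)

section \<open>Quaternionic polynomials\<close>

definition quat_norm2 :: "quat \<Rightarrow> real" where
  "quat_norm2 x = (Q0 x)\<^sup>2 + (Q1 x)\<^sup>2 + (Q2 x)\<^sup>2 + (Q3 x)\<^sup>2"

lemma quat_norm2_eq_0: "quat_norm2 x = 0 \<longleftrightarrow> x = 0"
  by (cases x) (auto simp: quat_norm2_def zero_quat_def add_nonneg_eq_0_iff)

lemma of_real_quat: "of_real r = Quat r 0 0 0"
  by (simp add: of_real_def quat_defs)

lemma mult_star_quat: "x * star x = of_real (quat_norm2 x)"
  and star_mult_quat: "star x * x = of_real (quat_norm2 x)"
  by (simp_all add: of_real_quat quat_defs star_quat_def quat_norm2_def power2_eq_square)

lemma add_star_quat: "x + star x = of_real (2 * Q0 x)"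
  by (simp add: of_real_quat quat_defs star_quat_def)

instantiation quat :: division_ring
begin

definition "inverse x = inverse (quat_norm2 x) *\<^sub>R star x"
definition "(x :: quat) div y = x * inverse y"

instance
proof
  fix a b :: quat
  assume a: "a \<noteq> 0"
  show "inverse a * a = 1" "a * inverse a = 1"
    using a by (simp_all add: inverse_quat_def mult_star_quat star_mult_quat of_real_def quat_norm2_eq_0)
qed (simp_all add: inverse_quat_def divide_quat_def)

end

lemma star_fixed_quat: "star x = x \<Longrightarrow> x = of_real (Q0 x)"
  by (cases x) (simp add: star_quat_def of_real_quat)

lemma star_fixed_commute: "star x = x \<Longrightarrow> x * y = y * (x :: quat)"
  by (metis Real_Vector_Spaces.of_real_def mult_scaleR_left mult_scaleR_right mult_1_left mult_1_right star_fixed_quat)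

text \<open>Coefficients fixed by \<open>star\<close> are real and hence central. This covers
  \<open>Delta y\<close> and all polynomials of the form \<open>a + poly_star a\<close> or
  \<open>a * poly_star a\<close>.\<close>

lemma poly_star_fixed_commute:
  fixes w p :: "quat npoly"
  assumes "poly_star w = w"
  shows "w * p = p * w"
proof (rule poly_mapping_eqI)
  fix n
  have "star (coeff w k) = coeff w k" for k
    using arg_cong[OF assms, of "\<lambda>w. coeff w k"] by simp
  then have *: "coeff w k * y = y * coeff w k" for k y
    by (rule star_fixed_commute)
  show "coeff (w * p) n = coeff (p * w) n"
    unfolding lookup_npoly_mult *
    by (rule sum.reindex_bij_witness[of _ "\<lambda>l. n - l" "\<lambda>l. n - l"]) auto
qed

section \<open>The quadratic polynomials \<open>Delta y\<close> and similarity classes of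
  quaternions\<close>

lemma Delta_commute: "Delta y * p = p * Delta (y :: quat)"
  by (simp add: poly_star_fixed_commute)

lemma Delta_commute_left: "p * (Delta y * q) = Delta (y :: quat) * (p * q)"
  by (metis Delta_commute mult.assoc)

lemma Delta_expand:
  "Delta y = indet * indet - cst (y + star y) * indet + cst (y * star (y :: 'a::star_ring))"
  by (simp add: Delta_def lin_eq algebra_simps mult_single single_add)

lemma Delta_star: "Delta (star y) = Delta (y :: quat)"
  by (simp add: Delta_expand add.commute mult_star_quat star_mult_quat)

lemma Delta_alt: "lin (star y) * lin y = Delta (y :: quat)"
  by (metis Delta_star Delta_def star_star)

lemma Delta_ldvd_mult: "Delta y ldvd q \<Longrightarrow> Delta (y :: quat) ldvd (p * q)"
  by (metis ldvd_def mult.assoc Delta_commute)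

text \<open>Two successive divisions, by \<open>lin z\<close> and by \<open>lin (star z)\<close>,
  force first \<open>b\<close> and then \<open>a\<close> to vanish.\<close>

lemma Delta_remainder_unique:
  assumes "Delta z * g = lin z * cst a + cst (b :: 'a::star_ring)"
  shows "a = 0" "b = 0"
proof -
  have "lin z * (lin (star z) * g - cst a) = cst b"
    using assms by (simp add: right_diff_distrib Delta_def mult.assoc)
  from lin_mult_eq_cst[OF this] show "b = 0" "a = 0"
    using lin_mult_eq_cst(2)[of "star z" g a] by simp_all
qed

lemma Delta_mult_cancel: "Delta y * p = 0 \<Longrightarrow> p = (0 :: quat npoly)"
  by (metis Delta_def lin_mult_cancel mult.assoc mult_zero_right)

text \<open>The hypothesis says that \<open>y\<close> is a root of \<open>Delta z\<close>. Its
  imaginary components give equal real parts unless \<open>y\<close> is real, and for real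
  \<open>y\<close> the equation is a vanishing sum of squares. Then the norms agree too, and real
  part and norm determine \<open>Delta\<close>.\<close>

lemma similar_if_root:
  fixes y z :: quat
  assumes "y * (z + star z) = y * y + z * star z"
  shows "Delta y = Delta z"
proof -
  obtain a a1 a2 a3 where y: "y = Quat a a1 a2 a3" by (cases y)
  obtain b b1 b2 b3 where z: "z = Quat b b1 b2 b3" by (cases z)
  have re: "2 * a * b = a\<^sup>2 - (a1\<^sup>2 + a2\<^sup>2 + a3\<^sup>2) + (b\<^sup>2 + b1\<^sup>2 + b2\<^sup>2 + b3\<^sup>2)"
    and im: "a1 * (a - b) = 0" "a2 * (a - b) = 0" "a3 * (a - b) = 0"
    using assms by (simp_all add: y z quat_defs star_quat_def power2_eq_square algebra_simps) argo+
  have "a = b"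
  proof (cases "a1 = 0 \<and> a2 = 0 \<and> a3 = 0")
    case True
    with re have "(a - b)\<^sup>2 + (b1\<^sup>2 + b2\<^sup>2 + b3\<^sup>2) = 0" by (simp add: power2_diff)
    then show ?thesis by (simp add: add_nonneg_eq_0_iff)
  qed (use im in auto)
  with re have "a1\<^sup>2 + a2\<^sup>2 + a3\<^sup>2 = b1\<^sup>2 + b2\<^sup>2 + b3\<^sup>2" by (simp add: power2_eq_square)
  with \<open>a = b\<close> have "Q0 y = Q0 z" "quat_norm2 y = quat_norm2 z"
    by (simp_all add: y z quat_norm2_def)
  then show ?thesis by (simp add: Delta_expand add_star_quat mult_star_quat)
qed

text \<open>Modulo \<open>Delta z\<close> the cofactor \<open>f\<close> is \<open>lin z * cst a + cst c\<close>, and divisibility turns into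
  two equations for \<open>a\<close> and \<open>c\<close>.\<close>

lemma Delta_ldvd_lin_mult:
  fixes y z :: quat
  assumes "Delta z ldvd lin y * f"
  shows "Delta z ldvd f \<or> Delta z = Delta y"
proof -
  obtain f' c where f': "f = lin z * f' + cst c" using lin_division by blast
  obtain g a where g: "f' = lin (star z) * g + cst a" using lin_division by blast
  have f: "f = Delta z * g + lin z * cst a + cst c"
    by (simp add: f' g Delta_def algebra_simps)
  obtain k where k: "lin y * f = Delta z * k" using assms unfolding ldvd_def by blast
  \<comment> \<open>With this \<open>e\<close>, \<open>lin y\<close> is
    \<open>lin (star z) + cst e\<close>, and the first summand times \<open>lin z\<close> is
    absorbed by \<open>Delta z\<close>.\<close>
  define e where "e = star z - y"
  have y: "lin y = lin (star z) + cst e"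
    by (simp add: lin_eq e_def single_diff)
  have "lin y * (lin z * cst a) = Delta z * cst a + cst e * (lin z * cst a)"
    unfolding y by (simp add: distrib_right Delta_alt flip: mult.assoc)
  also have "cst e * (lin z * cst a) = lin z * cst (e * a) + cst ((z * e - e * z) * a)"
    by (simp add: cst_lin[of e z z] distrib_right mult.assoc mult_single flip: mult.assoc)
      (simp add: mult.assoc mult_single)
  finally have 1: "lin y * (lin z * cst a)
      = Delta z * cst a + (lin z * cst (e * a) + cst ((z * e - e * z) * a))" .
  have 2: "lin y * cst c = lin z * cst c + cst ((z - y) * c)"
    by (simp add: lin_eq algebra_simps mult_single single_diff)
  have "Delta z * (k - lin y * g - cst a)
      = lin z * cst (e * a + c) + cst ((z * e - e * z) * a + (z - y) * c)"
    unfolding right_diff_distrib k[symmetric] f distrib_left 1 2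
    by (simp add: algebra_simps Delta_commute_left flip: single_add)
      (simp add: single_add distrib_left)
  from Delta_remainder_unique[OF this]
  have c: "c = - (e * a)" and eq: "(z * e - e * z) * a + (z - y) * c = 0"
    by (simp_all add: eq_neg_iff_add_eq_0 add.commute)
  show ?thesis
  proof (cases "a = 0")
    case True
    with f c have "f = Delta z * g" by simp
    then show ?thesis unfolding ldvd_def by blast
  next
    case False
    \<comment> \<open>Substituting \<open>c = - (e * a)\<close> into the second equation leaves the
      value of \<open>Delta z\<close> at \<open>y\<close>, up to sign, times
      \<open>a\<close>.\<close>
    have "(y * (z + star z) - (y * y + star z * z)) * a = 0"
      using eq unfolding c e_def by (simp add: algebra_simps)
    with False have "y * (z + star z) = y * y + z * star z"
      by (simp add: mult_star_quat star_mult_quat)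
    then show ?thesis using similar_if_root by metis
  qed
qed

text \<open>If \<open>p = lin y * c + Delta y * g\<close> vanishes at another point of the class of \<open>y\<close>, then \<open>c = 0\<close>.\<close>

lemma similar_zeros_eq:
  fixes p :: "quat npoly"
  assumes "lin y ldvd p" "lin z ldvd p" "Delta y = Delta z" "\<not> Delta y ldvd p"
  shows "y = z"
proof (rule ccontr)
  assume "y \<noteq> z"
  obtain p' where p: "p = lin y * p'" using assms(1) unfolding ldvd_def by blast
  obtain g c where p': "p' = lin (star y) * g + cst c" using lin_division by blast
  have "p = Delta y * g + lin y * cst c"
    by (simp add: p p' Delta_def distrib_left mult.assoc)
  then have "p = Delta z * g + lin y * cst c"
    using assms(3) by simp
  also have "lin y * cst c = lin z * cst c + cst ((z - y) * c)"
    by (simp add: lin_eq algebra_simps mult_single single_diff)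
  finally have pc: "p = lin z * (lin (star z) * g + cst c) + cst ((z - y) * c)"
    by (simp add: Delta_def algebra_simps)
  obtain k where "p = lin z * k" using assms(2) unfolding ldvd_def by blast
  with pc have "lin z * (k - (lin (star z) * g + cst c)) = cst ((z - y) * c)"
    by (simp add: right_diff_distrib)
  then have "c = 0" using \<open>y \<noteq> z\<close> lin_mult_eq_cst(2) by fastforce
  then have "p = Delta y * g" by (simp add: p p' Delta_def mult.assoc)
  with assms(4) show False unfolding ldvd_def by blast
qed

text \<open>Modulo right multiples of \<open>lin z\<close>, \<open>lin y * p\<close> agrees with
  \<open>cst u * p\<close>. Moving \<open>cst u\<close> past \<open>lin (inverse u * z * u)\<close>
  produces \<open>lin z\<close>, so the remainder \<open>c\<close> of \<open>p\<close> satisfies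
  \<open>u * c = 0\<close>.\<close>

lemma lin_ldvd_lin_mult:
  fixes p :: "quat npoly"
  assumes "lin z ldvd lin y * p" "y \<noteq> z"
  defines "u \<equiv> z - y"
  shows "lin (inverse u * z * u) ldvd p"
proof -
  have u: "u \<noteq> 0" using assms by simp
  obtain g c where p: "p = lin (inverse u * z * u) * g + cst c" using lin_division by blast
  obtain k where k: "lin y * p = lin z * k" using assms unfolding ldvd_def by blast
  have y: "lin y = lin z + cst u" by (simp add: lin_eq u_def single_diff)
  have "cst u * lin (inverse u * z * u) = lin z * cst u"
    using u by (simp add: cst_lin[of u _ z] flip: mult.assoc)
  then have "cst u * p = lin z * (cst u * g) + cst (u * c)"
    by (simp add: p distrib_left mult_single flip: mult.assoc)
  then have "lin z * (k - p - cst u * g) = cst (u * c)"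
    using k unfolding y by (simp add: algebra_simps)
  then have "c = 0" using u lin_mult_eq_cst(2) by fastforce
  then show ?thesis by (simp add: p ldvd_self_mult)
qed

text \<open>Trace and norm of \<open>z\<close> are real and commute with \<open>u\<close>, so the
  conjugate is still a root of \<open>Delta z\<close>.\<close>

lemma Delta_conjugate:
  assumes "u \<noteq> 0"
  shows "Delta (inverse u * z * u) = Delta (z :: quat)"
proof (rule similar_if_root)
  obtain s n :: real where c: "z + star z = of_real s" "z * star z = of_real n"
    using add_star_quat mult_star_quat by blast
  have of: "of_real r * x = x * of_real r" for r and x :: quat
    by (simp add: of_real_def)
  have "inverse u * z * u * (z + star z) = inverse u * (z * (z + star z)) * u"
    unfolding c by (simp add: mult.assoc of)
  also have "\<dots> = inverse u * z * z * u + inverse u * u * (z * star z)"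
    unfolding distrib_left c(2) by (simp add: algebra_simps of)
  also have "inverse u * z * z * u = (inverse u * z * u) * (inverse u * z * u)"
    using assms by (metis (no_types, lifting) mult.assoc mult_1_left right_inverse)
  finally show "inverse u * z * u * (z + star z)
    = inverse u * z * u * (inverse u * z * u) + z * star z" using assms by simp
qed

text \<open>\<open>z'\<close> is the solution of \<open>(t - y)(t - z) = (t - z')(t - y')\<close> in the class of \<open>z\<close>.\<close>

lemma similar_zero_lin_mult:
  fixes p :: "quat npoly"
  assumes "lin z ldvd p"
  shows "\<exists>z'. lin z' ldvd lin y * p \<and> Delta z' = Delta z"
proof (cases "star z = y")
  case True
  then show ?thesis using Delta_star ldvd_self_mult by blast
next
  case False
  \<comment> \<open>Taking \<open>y' = y + z - z'\<close> matches the linear coefficients and leaves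
    \<open>z' * (y + z - z') = y * z\<close>. Replacing the square of \<open>z'\<close> by means of
    the trace and norm of \<open>z\<close> makes this linear, namely
    \<open>z' * w = w * z\<close>.\<close>
  define w where "w = star z - y"
  have w: "w \<noteq> 0" using False by (simp add: w_def)
  define z' where "z' = w * z * inverse w"
  have "z' * w = w * z" using w by (simp add: z'_def mult.assoc)
  then have A: "z' * star z = z' * y + z * star z - y * z"
    by (simp add: w_def algebra_simps mult_star_quat star_mult_quat)
  have D: "Delta z' = Delta z"
    using Delta_conjugate[of "inverse w" z] w by (simp add: z'_def nonzero_inverse_inverse_eq)
  have B: "z' * z' = z' * (z + star z) - z * star z"
  proof -
    have "z' * (z' + star z') = z' * z' + z' * star z'" by (simp add: distrib_left)
    moreover have "z' + star z' = z + star z \<and> z' * star z' = z * star z"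
    proof -
      from D have "coeff (Delta z') n = coeff (Delta z) n" for n by simp
      from this[of 1] this[of 0] have "- (z' + star z') = - (z + star z)" "z' * star z' = z * star z"
        by (simp_all add: Delta_expand lookup_add lookup_minus mult_single lookup_single)
      then show ?thesis by (metis minus_minus)
    qed
    ultimately show ?thesis by (simp add: algebra_simps)
  qed
  have z'0: "z' * (y + z - z') = y * z"
    unfolding right_diff_distrib distrib_left B A by simp
  have "lin y * lin z = lin z' * lin (y + z - z') + cst (y * z - z' * (y + z - z'))"
    by (simp add: lin_eq algebra_simps mult_single single_diff single_add)
  with z'0 have "lin y * lin z = lin z' * lin (y + z - z')" by simp
  moreover obtain k where "p = lin z * k" using assms unfolding ldvd_def by blast
  ultimately have "lin y * p = lin z' * (lin (y + z - z') * k)"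
    by (metis mult.assoc)
  with D show ?thesis unfolding ldvd_def by blast
qed

section \<open>Linear left factors\<close>

text \<open>The hypotheses are, up to sign, the coefficients of the motion equation for
  \<open>lin (DQuat y v)\<close>. They say that \<open>v\<close> is imaginary with
  \<open>v * star y = y * v\<close>, so moving \<open>cst v\<close> to the right turns
  \<open>lin (star y)\<close> into \<open>lin y\<close>.\<close>

lemma linear_factor_condition:
  fixes y v :: quat
  assumes "v + star v = 0" "y * star v + v * star y = 0"
  shows "cst v * lin (star y) = lin y * cst v"
    and "lin y * cst (star v) + cst v * lin (star y) = 0"
proof -
  have v: "star v = - v" using assms(1) by (simp add: eq_neg_iff_add_eq_0 add.commute)
  with assms(2) have y: "v * star y = y * v" by (simp add: algebra_simps)
  show 1: "cst v * lin (star y) = lin y * cst v" by (simp add: cst_lin[of v _ y] y)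
  show "lin y * cst (star v) + cst v * lin (star y) = 0"
    by (simp add: 1 v flip: distrib_left single_add)
qed

lemma linear_factor_conditionI:
  fixes y v :: quat
  assumes "lin y * cst (star v) + cst v * lin (star y) = 0"
  shows "v + star v = 0" "y * star v + v * star y = 0"
proof -
  have "lin y * cst (star v + v) = cst (v * star y - y * v)"
    using assms unfolding cst_lin[of v _ y]
    by (simp add: single_add single_diff algebra_simps)
  from lin_mult_eq_cst[OF this] lin_mult_eq_cst(2)[of y "cst (star v + v)"]
  have 0: "cst (star v + v) = (0 :: quat npoly)" and *: "v * star y = y * v" by simp_all
  have "star v + v = coeff (cst (star v + v)) 0" by simp
  then show v: "v + star v = 0" unfolding 0 by (simp add: add.commute)
  have "y * star v + v * star y = y * (v + star v)" by (simp add: * distrib_left add.commute)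
  with v show "y * star v + v * star y = 0" by simp
qed

lemma linear_factor_exists:
  fixes p d :: "quat npoly"
  assumes M: "p * poly_star d + d * poly_star p = 0"
    and p: "p = lin y * p'" and nD: "\<not> Delta y ldvd p"
  shows "\<exists>v. v + star v = 0 \<and> y * star v + v * star y = 0 \<and> lin y ldvd (d + cst v * p')"
proof -
  obtain g c where p': "p' = lin (star y) * g + cst c" using lin_division by blast
  obtain e r where d: "d = lin y * e + cst r" using lin_division by blast
  have c: "c \<noteq> 0"
  proof
    assume "c = 0"
    then have "p = Delta y * g" by (simp add: p p' Delta_def mult.assoc)
    with nD show False unfolding ldvd_def by blast
  qed
  \<comment> \<open>Once \<open>cst v\<close> can be moved past \<open>lin (star y)\<close>, the
    remainder of \<open>d + cst v * p'\<close> is \<open>r + v * c\<close>; this \<open>v\<close>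
    makes it zero.\<close>
  define v where "v = - (r * inverse c)"
  have r: "r = - (v * c)" using c by (simp add: v_def mult.assoc)
  obtain n :: real where n: "c * star c = of_real n" and n0: "n \<noteq> 0"
    using mult_star_quat c by (metis quat_norm2_eq_0)
  have of: "of_real n * x = x * of_real n" for x :: quat
    by (simp add: of_real_def)
  \<comment> \<open>\<open>W\<close> is fixed by \<open>poly_star\<close>, hence central, so that
    \<open>lin y * W * lin (star y)\<close> is a multiple of \<open>Delta y\<close>.\<close>
  define W where "W = cst c * poly_star e + e * cst (star c)"
  have W: "W * q = q * W" for q
    by (rule poly_star_fixed_commute) (simp add: W_def poly_star_add poly_star_mult add.commute)
  have pe: "p = Delta y * g + lin y * cst c"
    by (simp add: p p' Delta_def distrib_left mult.assoc)
  have ps: "poly_star p = poly_star g * Delta y + cst (star c) * lin (star y)"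
    by (simp add: pe poly_star_add poly_star_mult)
  have ds: "poly_star d = poly_star e * lin (star y) + cst (star r)"
    by (simp add: d poly_star_add poly_star_mult)
  \<comment> \<open>The motion equation is expanded modulo \<open>Delta y\<close>: only the two
    terms containing \<open>r\<close> survive, and they will give both conditions on
    \<open>v\<close>.\<close>
  have "lin y * (cst c * cst (star r)) + cst r * (cst (star c) * lin (star y))
      + (lin y * W * lin (star y) + Delta y * (g * poly_star d + d * poly_star g))
    = p * poly_star d + d * poly_star p"
  proof -
    have "p * poly_star d + d * poly_star p
       = Delta y * g * poly_star d + lin y * cst c * poly_star d
         + (d * poly_star g * Delta y + d * (cst (star c) * lin (star y)))"
      unfolding ps by (subst (1) pe) (simp add: algebra_simps)
    also have "lin y * cst c * poly_star d
        = lin y * cst c * poly_star e * lin (star y) + lin y * (cst c * cst (star r))"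
      unfolding ds by (simp only: distrib_left mult.assoc)
    also have "d * (cst (star c) * lin (star y))
        = lin y * e * cst (star c) * lin (star y) + cst r * (cst (star c) * lin (star y))"
      unfolding d by (simp only: distrib_right mult.assoc)
    also have "d * poly_star g * Delta y = Delta y * (d * poly_star g)"
      by (rule Delta_commute[symmetric])
    finally show ?thesis unfolding W_def by (simp only: algebra_simps)
  qed
  moreover have "lin y * W * lin (star y) = Delta y * W"
    unfolding Delta_def by (simp only: mult.assoc W)
  ultimately have "lin y * (cst c * cst (star r)) + cst r * (cst (star c) * lin (star y))
      = Delta y * (- (W + (g * poly_star d + d * poly_star g)))"
    using M by (simp only: mult_minus_right distrib_left eq_neg_iff_add_eq_0)
  moreover have "cst c * cst (star r) = cst (c * star r)"
    "cst r * (cst (star c) * lin (star y)) = cst (r * star c) * lin (star y)"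
    by (simp_all add: mult_single flip: mult.assoc)
  ultimately have "Delta y * (- (W + (g * poly_star d + d * poly_star g)))
      = lin y * cst (c * star r) + cst (r * star c) * lin (star y)" by (simp only:)
  then have "Delta y * (- (W + (g * poly_star d + d * poly_star g)))
      = lin y * cst (c * star r + r * star c) + cst (y * (r * star c) - r * star c * star y)"
    by (simp only: cst_lin[of "r * star c" _ y] single_add distrib_left add.assoc)
  from Delta_remainder_unique[OF this]
  have "c * star r + r * star c = 0" and "y * (r * star c) - r * star c * star y = 0" .
  moreover have rc: "r * star c = - (of_real n * v)" "c * star r = - (of_real n * star v)"
  proof -
    have "r * star c = - (v * (c * star c))" by (simp add: r mult.assoc)
    then show "r * star c = - (of_real n * v)" by (simp only: n of)
    have "c * star r = - (c * star c * star v)" by (simp add: r star_minus star_mult mult.assoc)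
    then show "c * star r = - (of_real n * star v)" by (simp only: n)
  qed
  moreover have "y * (of_real n * v) = of_real n * (y * v)" by (metis mult.assoc of)
  ultimately have "of_real n * (v + star v) = 0" "of_real n * (v * star y - y * v) = 0"
    by (simp_all add: right_diff_distrib distrib_left mult.assoc add_eq_0_iff2)
  then have v1: "v + star v = 0" and v2: "v * star y = y * v"
    using n0 by simp_all
  have "y * star v + v * star y = y * (v + star v)" by (simp add: v2 distrib_left add.commute)
  then have v3: "y * star v + v * star y = 0" using v1 by simp
  have "cst v * p' = lin y * cst v * g + cst (v * c)"
    unfolding p' by (simp add: distrib_left mult_single linear_factor_condition(1)[OF v1 v3] flip: mult.assoc)
  then have "d + cst v * p' = lin y * (e + cst v * g)"
    by (simp add: d r distrib_left mult.assoc single_uminus)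
  then show ?thesis using v1 v3 ldvd_self_mult by metis
qed

text \<open>The conditions on \<open>v\<close> are additive, so the difference \<open>u\<close> of
  two solutions satisfies them. Then \<open>cst u * p'\<close> has remainder \<open>u * c\<close>,
  which must vanish although \<open>c\<close> does not.\<close>

lemma linear_factor_unique:
  fixes p' d :: "quat npoly"
  assumes nD: "\<not> Delta y ldvd lin y * p'"
    and v: "v + star v = 0" "y * star v + v * star y = 0" "lin y ldvd (d + cst v * p')"
    and w: "w + star w = 0" "y * star w + w * star y = 0" "lin y ldvd (d + cst w * p')"
  shows "v = w"
proof -
  obtain g c where p': "p' = lin (star y) * g + cst c" using lin_division by blast
  have c: "c \<noteq> 0"
  proof
    assume "c = 0"
    then have "lin y * p' = Delta y * g" by (simp add: p' Delta_def mult.assoc)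
    with nD show False unfolding ldvd_def by blast
  qed
  define u where "u = v - w"
  have u: "u + star u = 0" "y * star u + u * star y = 0"
  proof -
    have "u + star u = (v + star v) - (w + star w)"
      "y * star u + u * star y = (y * star v + v * star y) - (y * star w + w * star y)"
      by (simp_all add: u_def star_diff algebra_simps)
    then show "u + star u = 0" "y * star u + u * star y = 0" using v(1,2) w(1,2) by simp_all
  qed
  have "lin y ldvd (d + cst v * p' - (d + cst w * p'))" by (rule ldvd_diff[OF v(3) w(3)])
  also have "d + cst v * p' - (d + cst w * p') = lin y * cst u * g + cst (u * c)"
  proof -
    have "d + cst v * p' - (d + cst w * p') = cst u * p'"
      by (simp add: u_def single_diff left_diff_distrib)
    then show ?thesis unfolding p'
      by (simp add: distrib_left mult_single linear_factor_condition(1)[OF u] flip: mult.assoc)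
  qed
  finally obtain k where "lin y * cst u * g + cst (u * c) = lin y * k" unfolding ldvd_def by blast
  then have "lin y * (k - cst u * g) = cst (u * c)" by (simp add: algebra_simps)
  then have "u = 0" using c lin_mult_eq_cst(2) by fastforce
  then show ?thesis by (simp add: u_def)
qed

text \<open>Here \<open>d\<close> is the dual part of \<open>lin (DQuat y v)\<close> times the
  cofactor. By centrality of \<open>N\<close> and \<open>W\<close> the left side equals
  \<open>Delta y * W\<close>, and \<open>Delta y\<close> can be cancelled.\<close>

lemma motion_lin_mult_iff:
  fixes p' d' :: "quat npoly"
  assumes v: "v + star v = 0" "y * star v + v * star y = 0"
  defines "p \<equiv> lin y * p'" and "d \<equiv> lin y * d' - cst v * p'"
  shows "p * poly_star d + d * poly_star p = 0 \<longleftrightarrow> p' * poly_star d' + d' * poly_star p' = 0"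
proof -
  define N where "N = p' * poly_star p'"
  define W where "W = p' * poly_star d' + d' * poly_star p'"
  have N: "N * q = q * N" for q
    by (rule poly_star_fixed_commute) (simp add: N_def poly_star_mult)
  have W: "W * q = q * W" for q
    by (rule poly_star_fixed_commute) (simp add: W_def poly_star_add poly_star_mult add.commute)
  have "p * poly_star d + d * poly_star p
    = lin y * W * lin (star y) - (lin y * N * cst (star v) + cst v * N * lin (star y))"
    unfolding p_def d_def W_def N_def
    by (simp add: poly_star_mult poly_star_diff algebra_simps)
  also have "lin y * N * cst (star v) + cst v * N * lin (star y)
      = (lin y * cst (star v) + cst v * lin (star y)) * N"
    by (simp only: mult.assoc N distrib_right)
  also have "\<dots> = 0" by (simp add: linear_factor_condition(2)[OF v])
  also have "lin y * W * lin (star y) = Delta y * W"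
    unfolding Delta_def by (simp only: mult.assoc W)
  finally show ?thesis using Delta_mult_cancel[of y W] unfolding W_def by auto
qed

section \<open>Dual quaternion polynomials\<close>

definition poly_dual :: "dquat npoly \<Rightarrow> quat npoly" where
  "poly_dual p = Poly_Mapping.map dual p"

lemma coeff_poly_primal [simp]: "coeff (poly_primal P) n = primal (coeff P n)"
  and coeff_poly_dual [simp]: "coeff (poly_dual P) n = dual (coeff P n)"
  by (simp_all add: poly_primal_def poly_dual_def lookup_map_zero dquat_defs)

lemma primal_simps [simp]:
  "primal 0 = 0" "primal 1 = 1" "primal (x + y) = primal x + primal y"
  "primal (- x) = - primal x" "primal (x - y) = primal x - primal y"
  "primal (x * y) = primal x * primal y" "primal (star x) = star (primal x)"
  and dual_simps [simp]:
  "dual 0 = 0" "dual 1 = 0" "dual (x + y) = dual x + dual y"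
  "dual (- x) = - dual x" "dual (x - y) = dual x - dual y"
  "dual (x * y) = primal x * dual y + dual x * primal y" "dual (star x) = star (dual x)"
  by (simp_all add: dquat_defs star_dquat_def)

lemma primal_sum: "primal (sum f A) = (\<Sum>a\<in>A. primal (f a))"
  and dual_sum: "dual (sum f A) = (\<Sum>a\<in>A. dual (f a))"
  by (induction A rule: infinite_finite_induct) simp_all

lemma poly_primal_mult: "poly_primal (P * Q) = poly_primal P * poly_primal Q"
  by (rule poly_mapping_eqI) (simp add: lookup_npoly_mult primal_sum)

lemma poly_dual_mult:
  "poly_dual (P * Q) = poly_primal P * poly_dual Q + poly_dual P * poly_primal Q"
  by (rule poly_mapping_eqI) (simp add: lookup_npoly_mult lookup_add dual_sum sum.distrib)

lemma poly_primal_lin [simp]: "poly_primal (lin h) = lin (primal h)"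
  and poly_dual_lin [simp]: "poly_dual (lin h) = - cst (dual h)"
  by (auto intro!: poly_mapping_eqI simp: lin_def lookup_minus lookup_single when_def)

lemma poly_primal_one [simp]: "poly_primal 1 = 1"
  by (rule poly_mapping_eqI) (simp add: lookup_one when_def)

lemma poly_primal_prod_lin:
  "poly_primal (prod_list (map lin hs)) = prod_list (map lin (map primal hs))"
  by (induction hs) (simp_all add: poly_primal_mult)

lemma poly_primal_star: "poly_primal (poly_star P) = poly_star (poly_primal P)"
  and poly_dual_star: "poly_dual (poly_star P) = poly_star (poly_dual P)"
  by (auto intro!: poly_mapping_eqI)

lemma dquat_poly_eq_iff: "P = Q \<longleftrightarrow> poly_primal P = poly_primal Q \<and> poly_dual P = poly_dual Q"
proof
  assume *: "poly_primal P = poly_primal Q \<and> poly_dual P = poly_dual Q"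
  have "coeff P n = coeff Q n" for n
    using *[THEN conjunct1, THEN arg_cong[of _ _ "\<lambda>p. coeff p n"]]
      *[THEN conjunct2, THEN arg_cong[of _ _ "\<lambda>p. coeff p n"]]
    by (simp add: dquat.expand)
  then show "P = Q" by (rule poly_mapping_eqI)
qed simp

lemma dquat_poly_exists:
  obtains P where "poly_primal P = p" "poly_dual P = d"
proof
  let ?P = "Poly_Mapping.map (\<lambda>a. DQuat a 0) p + Poly_Mapping.map (DQuat 0) d"
  show "poly_primal ?P = p" "poly_dual ?P = d"
    by (auto intro!: poly_mapping_eqI simp: lookup_add lookup_map_zero zero_dquat_def)
qed

text \<open>This is the vanishing of the dual part of \<open>poly_norm P\<close>. The primal part is
  fixed by \<open>poly_star\<close>, so its coefficients are always real.\<close>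

definition real_norm :: "dquat npoly \<Rightarrow> bool" where
  "real_norm P \<longleftrightarrow> poly_primal P * poly_star (poly_dual P) + poly_dual P * poly_star (poly_primal P) = 0"

lemma dquat_real_iff: "x \<in> \<real> \<longleftrightarrow> star (primal x) = primal x \<and> dual x = 0"
proof -
  have of: "of_real r = DQuat (of_real r) 0" for r
    by (simp add: of_real_def dquat_defs)
  show ?thesis
  proof
    assume "x \<in> \<real>"
    then show "star (primal x) = primal x \<and> dual x = 0"
      by (auto elim!: Reals_cases simp: of of_real_quat star_quat_def)
  next
    assume "star (primal x) = primal x \<and> dual x = 0"
    then have "x = of_real (Q0 (primal x))"
      using star_fixed_quat[of "primal x"] by (simp add: of dquat.expand)
    then show "x \<in> \<real>" by (metis Reals_of_real)
  qed
qed

lemma motion_poly_iff: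
  "motion_poly P \<longleftrightarrow> real_norm P \<and> (\<exists>u. leading P * u = 1 \<and> u * leading P = 1)"
proof -
  have "star (coeff (poly_primal P * poly_star (poly_primal P)) k)
      = coeff (poly_primal P * poly_star (poly_primal P)) k" for k
  proof -
    have "poly_star (poly_primal P * poly_star (poly_primal P))
      = poly_primal P * poly_star (poly_primal P)" by (simp add: poly_star_mult)
    from arg_cong[OF this, of "\<lambda>p. coeff p k"] show ?thesis by simp
  qed
  moreover have "primal (coeff (poly_norm P) k) = coeff (poly_primal P * poly_star (poly_primal P)) k"
    "dual (coeff (poly_norm P) k) = coeff (poly_primal P * poly_star (poly_dual P) + poly_dual P * poly_star (poly_primal P)) k" for k
    by (simp_all only: poly_norm_def poly_primal_mult poly_dual_mult poly_primal_star poly_dual_star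
        flip: coeff_poly_primal coeff_poly_dual)
  ultimately have "(\<forall>k. coeff (poly_norm P) k \<in> \<real>) \<longleftrightarrow> real_norm P"
    unfolding dquat_real_iff real_norm_def by (auto intro: poly_mapping_eqI)
  then show ?thesis unfolding motion_poly_def by simp
qed

lemma monic_motion_poly_iff: "leading P = 1 \<Longrightarrow> motion_poly P \<longleftrightarrow> real_norm P"
  by (simp add: motion_poly_iff)

text \<open>In coordinates the right side says that the dual part is imaginary and orthogonal to the
  imaginary part of the primal part. This turns membership into the algebraic condition used for
  linear factors.\<close>

lemma mem_linear_set_iff:
  "h \<in> R_eps_Im \<union> Q_DH \<longleftrightarrow> dual h + star (dual h) = 0
    \<and> primal h * star (dual h) + dual h * star (primal h) = 0"
proof -
  obtain a a1 a2 a3 b b1 b2 b3 where h: "h = DQuat (Quat a a1 a2 a3) (Quat b b1 b2 b3)"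
    by (metis dquat.exhaust quat.exhaust)
  have R: "h \<in> R_eps_Im \<longleftrightarrow> a1 = 0 \<and> a2 = 0 \<and> a3 = 0 \<and> b = 0"
    by (auto simp: R_eps_Im_def Im_quat_def h of_real_quat)
  have cond: "(dual h + star (dual h) = 0
      \<and> primal h * star (dual h) + dual h * star (primal h) = 0)
    \<longleftrightarrow> b = 0 \<and> a1 * b1 + a2 * b2 + a3 * b3 = 0"
    by (auto simp: h quat_defs star_quat_def)
  have S: "DQuat (Quat c c1 c2 c3) (Quat d d1 d2 d3) \<in> S_DH \<longleftrightarrow>
    c = 0 \<and> d = 0 \<and> c1\<^sup>2 + c2\<^sup>2 + c3\<^sup>2 = 1 \<and> c1 * d1 + c2 * d2 + c3 * d3 = 0" for c c1 c2 c3 d d1 d2 d3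
    by (auto simp: S_DH_def dquat_defs star_dquat_def quat_defs star_quat_def power2_eq_square
        algebra_simps)
  have Q: "b = 0 \<and> a1 * b1 + a2 * b2 + a3 * b3 = 0" if "h \<in> Q_DH"
  proof -
    from that obtain \<alpha> \<beta> J where J: "J \<in> S_DH" and "h = of_real \<alpha> + \<beta> *\<^sub>R J"
      unfolding Q_DH_def by blast
    moreover obtain c c1 c2 c3 d d1 d2 d3 where "J = DQuat (Quat c c1 c2 c3) (Quat d d1 d2 d3)"
      by (metis dquat.exhaust quat.exhaust)
    moreover from J this S
    have "c = 0" "d = 0" "c1 * d1 + c2 * d2 + c3 * d3 = 0" by simp_all
    moreover have "\<beta> * c1 * (\<beta> * d1) + \<beta> * c2 * (\<beta> * d2) + \<beta> * c3 * (\<beta> * d3)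
      = \<beta>\<^sup>2 * (c1 * d1 + c2 * d2 + c3 * d3)" by (simp add: algebra_simps power2_eq_square)
    ultimately show ?thesis
      by (simp add: h dquat_defs of_real_def quat_defs mult.assoc)
  qed
  have "h \<in> R_eps_Im \<or> h \<in> Q_DH" if b: "b = 0" "a1 * b1 + a2 * b2 + a3 * b3 = 0"
  proof (cases "a1 = 0 \<and> a2 = 0 \<and> a3 = 0")
    case False
    \<comment> \<open>For a primal part that is not real, dividing both imaginary parts by the
      length \<open>s\<close> gives a \<open>J\<close> in \<open>S_DH\<close>.\<close>
    define s where "s = sqrt (a1\<^sup>2 + a2\<^sup>2 + a3\<^sup>2)"
    have pos: "a1\<^sup>2 + a2\<^sup>2 + a3\<^sup>2 \<noteq> 0" using False by (auto simp: add_nonneg_eq_0_iff)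
    then have s: "s \<noteq> 0" "s\<^sup>2 = a1\<^sup>2 + a2\<^sup>2 + a3\<^sup>2" by (simp_all add: s_def)
    define J where "J = DQuat (Quat 0 (a1/s) (a2/s) (a3/s)) (Quat 0 (b1/s) (b2/s) (b3/s))"
    have "(a1/s)\<^sup>2 + (a2/s)\<^sup>2 + (a3/s)\<^sup>2 = (a1\<^sup>2 + a2\<^sup>2 + a3\<^sup>2) / s\<^sup>2"
      by (simp add: power_divide add_divide_distrib)
    also have "\<dots> = 1" using s pos by simp
    finally have 1: "(a1/s)\<^sup>2 + (a2/s)\<^sup>2 + (a3/s)\<^sup>2 = 1" .
    have "(a1/s) * (b1/s) + (a2/s) * (b2/s) + (a3/s) * (b3/s) = (a1 * b1 + a2 * b2 + a3 * b3) / (s * s)"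
      by (simp add: add_divide_distrib)
    with 1 b have "J \<in> S_DH" unfolding J_def S by simp
    moreover have "h = of_real a + s *\<^sub>R J"
      using b s by (simp add: h J_def dquat_defs of_real_def quat_defs)
    ultimately show ?thesis unfolding Q_DH_def by blast
  qed (use R b in simp)
  with R Q cond show ?thesis by auto
qed

section \<open>Splitting linear left factors off dual quaternion polynomials\<close>

lemma lin_mult_dquat_eq_iff:
  "P = lin h * P' \<longleftrightarrow> poly_primal P = lin (primal h) * poly_primal P'
    \<and> poly_dual P = lin (primal h) * poly_dual P' - cst (dual h) * poly_primal P'"
  unfolding dquat_poly_eq_iff[of P] poly_primal_mult poly_dual_mult by simp

lemma real_norm_lin_mult_iff:
  assumes "h \<in> R_eps_Im \<union> Q_DH"
  shows "real_norm (lin h * P) \<longleftrightarrow> real_norm P"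
  using motion_lin_mult_iff[of "dual h" "primal h" "poly_primal P" "poly_dual P"] assms
  unfolding mem_linear_set_iff real_norm_def poly_primal_mult poly_dual_mult by simp

lemma real_norm_one: "real_norm 1"
proof -
  have "poly_dual 1 = 0" by (rule poly_mapping_eqI) (simp add: lookup_one when_def)
  moreover have "poly_star (0 :: quat npoly) = 0" by (rule poly_mapping_eqI) simp
  ultimately show ?thesis by (simp add: real_norm_def)
qed

lemma real_norm_prod_lin:
  assumes "set hs \<subseteq> R_eps_Im \<union> Q_DH"
  shows "real_norm (prod_list (map lin hs) * P) \<longleftrightarrow> real_norm P"
  using assms by (induction hs) (simp_all add: real_norm_lin_mult_iff mult.assoc)

lemma real_norm_lin_iff: "real_norm (lin h) \<longleftrightarrow> h \<in> R_eps_Im \<union> Q_DH"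
proof
  assume "real_norm (lin h)"
  then have "- (lin (primal h) * cst (star (dual h)) + cst (dual h) * lin (star (primal h))) = 0"
    unfolding real_norm_def poly_primal_lin poly_dual_lin poly_star_minus poly_star_cst poly_star_lin
    by (simp only: mult_minus_right mult_minus_left minus_add_distrib)
  then have "lin (primal h) * cst (star (dual h)) + cst (dual h) * lin (star (primal h)) = 0"
    by (simp only: neg_equal_0_iff_equal)
  from linear_factor_conditionI[OF this] show "h \<in> R_eps_Im \<union> Q_DH"
    unfolding mem_linear_set_iff by simp
next
  assume "h \<in> R_eps_Im \<union> Q_DH"
  from real_norm_lin_mult_iff[OF this, of 1] show "real_norm (lin h)" by (simp add: real_norm_one)
qed

lemma real_norm_split:
  assumes "real_norm P" "lin y ldvd poly_primal P" "\<not> Delta y ldvd poly_primal P"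
  obtains h P' where "h \<in> R_eps_Im \<union> Q_DH" "primal h = y" "P = lin h * P'" "real_norm P'"
proof -
  obtain p' where p: "poly_primal P = lin y * p'" using assms(2) unfolding ldvd_def by blast
  obtain v where v: "v + star v = 0" "y * star v + v * star y = 0"
    "lin y ldvd (poly_dual P + cst v * p')"
    using linear_factor_exists[OF _ p assms(3)] assms(1) unfolding real_norm_def by blast
  then obtain d' where "poly_dual P + cst v * p' = lin y * d'" unfolding ldvd_def by blast
  then have d: "poly_dual P = lin y * d' - cst v * p'" by (simp add: eq_diff_eq)
  obtain P' where "poly_primal P' = p'" "poly_dual P' = d'" by (rule dquat_poly_exists)
  with p d have P: "P = lin (DQuat y v) * P'" unfolding lin_mult_dquat_eq_iff by simp
  have S: "DQuat y v \<in> R_eps_Im \<union> Q_DH" unfolding mem_linear_set_iff using v by simp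
  with P assms(1) have "real_norm P'" using real_norm_lin_mult_iff by blast
  with S P show thesis using that[of "DQuat y v" P'] by simp
qed

text \<open>Equal primal parts \<open>primal h = primal k\<close> make the primal cofactors equal by
  cancellation, so both dual parts solve the same problem for the same polynomial.\<close>

lemma real_norm_split_unique:
  assumes "h \<in> R_eps_Im \<union> Q_DH" "k \<in> R_eps_Im \<union> Q_DH" "primal h = primal k"
    and "lin h * P = lin k * Q" "\<not> Delta (primal h) ldvd poly_primal (lin h * P)"
  shows "h = k" "P = Q"
proof -
  define R where "R = lin h * P"
  have R: "R = lin h * P" "R = lin k * Q" using assms by (simp_all add: R_def)
  note P = R(1)[unfolded lin_mult_dquat_eq_iff] and Q = R(2)[unfolded lin_mult_dquat_eq_iff]
  have pq: "poly_primal P = poly_primal Q"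
    using P[THEN conjunct1] Q[THEN conjunct1] unfolding assms(3) by (metis lin_mult_cancel)
  have "dual h = dual k"
  proof (rule linear_factor_unique[of "primal h" "poly_primal P" _ "poly_dual R"])
    show "\<not> Delta (primal h) ldvd lin (primal h) * poly_primal P"
      using assms(5) by (simp add: poly_primal_mult)
    have "poly_dual R + cst (dual h) * poly_primal P = lin (primal h) * poly_dual P" using P by simp
    then show "lin (primal h) ldvd poly_dual R + cst (dual h) * poly_primal P"
      by (simp add: ldvd_self_mult)
    have "poly_dual R + cst (dual k) * poly_primal P = lin (primal h) * poly_dual Q"
      using Q pq assms(3) by simp
    then show "lin (primal h) ldvd poly_dual R + cst (dual k) * poly_primal P"
      by (simp add: ldvd_self_mult)
  qed (use assms(1-3) in \<open>simp_all add: mem_linear_set_iff del: Un_iff\<close>)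
  then show "h = k" using assms(3) by (simp add: dquat.expand)
  with assms(4) show "P = Q" by (simp add: lin_mult_cancel)
qed

section \<open>Factorizations into linear factors\<close>

abbreviation (input) motion_points :: "dquat set" where "motion_points \<equiv> R_eps_Im \<union> Q_DH"

section \<open>Zeros of products of linear factors, and counting factorizations\<close>

lemma not_lin_ldvd_one: "\<not> lin z ldvd (1 :: 'a::ring_1 npoly)"
  using lin_mult_eq_cst(2)[of z _ 1] by (auto simp: ldvd_def)

lemma not_Delta_ldvd_one: "\<not> Delta z ldvd (1 :: quat npoly)"
  using not_lin_ldvd_one[of z] by (auto simp: ldvd_def Delta_def mult.assoc)

text \<open>A zero other than the first factor's point becomes, after conjugation, a zero of the
  remaining product in the same class.\<close>

lemma zero_prod_lin_similar:
  fixes ys :: "quat list"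
  assumes "lin z ldvd prod_list (map lin ys)"
  shows "\<exists>y\<in>set ys. Delta z = Delta y"
  using assms
proof (induction ys arbitrary: z)
  case Nil
  then show ?case by (simp add: not_lin_ldvd_one)
next
  case (Cons y ys)
  show ?case
  proof (cases "y = z")
    case False
    with Cons.prems have "lin (inverse (z - y) * z * (z - y)) ldvd prod_list (map lin ys)"
      using lin_ldvd_lin_mult by simp
    from Cons.IH[OF this] show ?thesis using False by (simp add: Delta_conjugate)
  qed simp
qed

text \<open>Only the first factor directly yields a zero. For later factors a zero in the right
  class is carried through the preceding factors, which lets \<open>Delta_covered\<close> be applied
  to every factor.\<close>

lemma prod_lin_zero_in_class:
  fixes ys :: "quat list"
  assumes "y \<in> set ys"
  shows "\<exists>z. lin z ldvd prod_list (map lin ys) \<and> Delta z = Delta y"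
  using assms
proof (induction ys)
  case (Cons a ys)
  show ?case
  proof (cases "y = a")
    case True
    then show ?thesis by (auto intro: ldvd_self_mult)
  next
    case False
    with Cons obtain z where "lin z ldvd prod_list (map lin ys)" "Delta z = Delta y" by auto
    then show ?thesis using similar_zero_lin_mult[of z _ a] by simp
  qed
qed simp

text \<open>The first factor comes from a zero of \<open>p\<close>, and there are at most
  \<open>Suc q\<close> zeros when one factorization has \<open>Suc q\<close> factors. Induction on
  the quotients gives the factorial.\<close>

lemma lin_factorizations_UNIV_bound:
  fixes p :: "quat npoly"
  assumes "\<And>z. \<not> Delta z ldvd p"
  shows "finite (lin_factorizations UNIV q p) \<and> card (lin_factorizations UNIV q p) \<le> fact q"
  using assms
proof (induction q arbitrary: p)
  case 0
  have "lin_factorizations UNIV 0 p \<subseteq> {[]}" by (auto simp: lin_factorizations_def)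
  then have "finite (lin_factorizations UNIV 0 p)" "card (lin_factorizations UNIV 0 p) \<le> card {[] :: quat list}"
    using finite_subset card_mono by blast+
  then show ?case by simp
next
  case (Suc q)
  show ?case
  proof (cases "lin_factorizations UNIV (Suc q) p = {}")
    case False
    then obtain ys where ys: "length ys = Suc q" "p = prod_list (map lin ys)"
      unfolding lin_factorizations_def by blast
    \<comment> \<open>\<open>Delta\<close> is injective on zeros, as no \<open>Delta z\<close>
      divides \<open>p\<close>, and its values come from the factors of the fixed factorization
      \<open>ys\<close>.\<close>
    define Z where "Z = {z. lin z ldvd p}"
    have inj: "inj_on Delta Z"
      by (rule inj_onI) (use similar_zeros_eq Suc.prems in \<open>auto simp: Z_def\<close>)
    have sub: "Delta ` Z \<subseteq> Delta ` set ys"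
      using zero_prod_lin_similar unfolding Z_def ys(2) by blast
    have finZ: "finite Z"
      by (rule finite_imageD[OF finite_subset[OF sub] inj]) simp
    have "card Z = card (Delta ` Z)" using card_image[OF inj] by simp
    also have "\<dots> \<le> card (Delta ` set ys)" using sub by (intro card_mono) auto
    also have "\<dots> \<le> Suc q" using ys(1) by (metis card_image_le card_length finite_set le_trans)
    finally have cardZ: "card Z \<le> Suc q" .
    \<comment> \<open>By left cancellation this chosen quotient is the only one.\<close>
    define quot where "quot z = (SOME p'. p = lin z * p')" for z
    have quot: "p = lin z * quot z" if "z \<in> Z" for z
      using that unfolding Z_def ldvd_def quot_def by (metis (mono_tags, lifting) mem_Collect_eq someI_ex)
    define F where "F z = (#) z ` lin_factorizations UNIV q (quot z)" for z
    have IH: "finite (F z) \<and> card (F z) \<le> fact q" if "z \<in> Z" for z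
    proof -
      have "\<not> Delta x ldvd quot z" for x
        using Suc.prems[of x] quot[OF that] Delta_ldvd_mult by metis
      from Suc.IH[OF this] show ?thesis
        unfolding F_def by (meson card_image_le finite_imageI le_trans)
    qed
    have cover: "lin_factorizations UNIV (Suc q) p \<subseteq> (\<Union>z\<in>Z. F z)"
    proof
      fix xs assume xs: "xs \<in> lin_factorizations UNIV (Suc q) p"
      then obtain z zs where z: "xs = z # zs" "length zs = q" "p = lin z * prod_list (map lin zs)"
        unfolding lin_factorizations_def by (cases xs) auto
      then have "z \<in> Z" by (simp add: Z_def ldvd_self_mult)
      with quot z(3) have "quot z = prod_list (map lin zs)" by (metis lin_mult_cancel)
      with z \<open>z \<in> Z\<close> show "xs \<in> (\<Union>z\<in>Z. F z)" unfolding F_def lin_factorizations_def by blast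
    qed
    have fin: "finite (\<Union>z\<in>Z. F z)" using finZ IH by blast
    have "card (lin_factorizations UNIV (Suc q) p) \<le> card (\<Union>z\<in>Z. F z)"
      by (rule card_mono[OF fin cover])
    also have "\<dots> \<le> (\<Sum>z\<in>Z. card (F z))" by (rule card_UN_le[OF finZ])
    also have "\<dots> \<le> (\<Sum>z\<in>Z. fact q)" by (rule sum_mono) (use IH in blast)
    also have "\<dots> \<le> fact (Suc q)" using mult_le_mono1[OF cardZ, of "fact q"] by simp
    finally show ?thesis using finite_subset[OF cover fin] by blast
  qed simp
qed

section \<open>Correspondence between factorizations of a polynomial and of its primal part\<close>

lemma lin_factorizations_primal_inj:
  assumes "set hs \<subseteq> motion_points" "set ks \<subseteq> motion_points" "map primal hs = map primal ks"
    and "prod_list (map lin hs) = prod_list (map lin ks)"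
    and "\<And>z. \<not> Delta z ldvd poly_primal (prod_list (map lin hs))"
  shows "hs = ks"
  using assms
proof (induction hs arbitrary: ks)
  case (Cons h hs)
  then obtain k ks' where k: "ks = k # ks'" "primal h = primal k" "map primal hs = map primal ks'"
    by auto
  have "h = k" "prod_list (map lin hs) = prod_list (map lin ks')"
    using real_norm_split_unique[of h k "prod_list (map lin hs)" "prod_list (map lin ks')"] Cons.prems k
    by (simp_all del: Un_iff)
  moreover have "\<not> Delta z ldvd poly_primal (prod_list (map lin hs))" for z
    using Cons.prems(5)[of z] Delta_ldvd_mult by (auto simp: poly_primal_mult)
  ultimately show ?case using Cons.IH[of ks'] Cons.prems k by simp
qed simp

text \<open>The factors are lifted one at a time from the left. The cofactor again has no divisor
  \<open>Delta z\<close>, because central \<open>Delta z\<close> would then divide the whole primal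
  part.\<close>

lemma lin_factorization_lift:
  assumes "real_norm Q" "leading Q = 1" "deg Q = length ys" "poly_primal Q = prod_list (map lin ys)"
    and "\<And>z. \<not> Delta z ldvd poly_primal Q"
  shows "\<exists>hs. set hs \<subseteq> motion_points \<and> map primal hs = ys \<and> Q = prod_list (map lin hs)"
  using assms
proof (induction ys arbitrary: Q)
  case Nil
  then show ?case using monic_deg_0[of Q] by simp
next
  case (Cons y ys)
  have "lin y ldvd poly_primal Q" using Cons.prems(4) by (simp add: ldvd_self_mult)
  then obtain h Q' where h: "h \<in> motion_points" "primal h = y" "Q = lin h * Q'" "real_norm Q'"
    using real_norm_split Cons.prems(1,5) by blast
  note m = monic_lin_mult_iff[of h Q', folded h(3), OF Cons.prems(2)]
  have Q': "poly_primal Q' = prod_list (map lin ys)"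
    using Cons.prems(4) h(2,3) by (simp add: poly_primal_mult)
  have "\<not> Delta z ldvd poly_primal Q'" for z
    using Cons.prems(5)[of z] Delta_ldvd_mult by (auto simp: h(3) poly_primal_mult)
  with Cons.IH[OF h(4) m(1) _ Q'] m(2) Cons.prems(3) obtain hs where
    "set hs \<subseteq> motion_points" "map primal hs = ys" "Q' = prod_list (map lin hs)" by auto
  then show ?case using h by (intro exI[of _ "h # hs"]) simp
qed

lemma lin_factorizations_primal_bij:
  assumes "real_norm Q" "leading Q = 1" "deg Q = q" "\<And>z. \<not> Delta z ldvd poly_primal Q"
  shows "bij_betw (map primal) (lin_factorizations motion_points q Q)
    (lin_factorizations UNIV q (poly_primal Q))"
  unfolding bij_betw_def
proof
  show "inj_on (map primal) (lin_factorizations motion_points q Q)"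
    by (rule inj_onI, rule lin_factorizations_primal_inj)
      (use assms(4) in \<open>auto simp: lin_factorizations_def simp del: Un_iff\<close>)
  show "map primal ` lin_factorizations motion_points q Q = lin_factorizations UNIV q (poly_primal Q)"
  proof
    show "map primal ` lin_factorizations motion_points q Q \<subseteq> lin_factorizations UNIV q (poly_primal Q)"
      by (auto simp: lin_factorizations_def poly_primal_prod_lin)
    show "lin_factorizations UNIV q (poly_primal Q) \<subseteq> map primal ` lin_factorizations motion_points q Q"
    proof
      fix ys assume "ys \<in> lin_factorizations UNIV q (poly_primal Q)"
      then have ys: "length ys = q" "poly_primal Q = prod_list (map lin ys)"
        unfolding lin_factorizations_def by auto
      with lin_factorization_lift[of Q ys] assms obtain hs where
        "set hs \<subseteq> motion_points" "map primal hs = ys" "Q = prod_list (map lin hs)" by metis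
      with ys(1) show "ys \<in> map primal ` lin_factorizations motion_points q Q"
        unfolding lin_factorizations_def by force
    qed
  qed
qed

text \<open>Induction on the degree: as long as a zero \<open>y\<close> of the primal part violates
  coveredness, the linear factor above \<open>y\<close> is split off.\<close>

lemma Delta_free_covered_split:
  assumes "real_norm P" "leading P = 1"
  shows "\<exists>hs R. set hs \<subseteq> motion_points \<and> P = prod_list (map lin hs) * R \<and> leading R = 1 \<and>
    real_norm R \<and> Delta_covered R \<and> (\<forall>z. \<not> Delta z ldvd poly_primal (prod_list (map lin hs)))"
  using assms
proof (induction "deg P" arbitrary: P rule: less_induct)
  case less
  show ?case
  proof (cases "Delta_covered P")
    case True
    with less.prems show ?thesis
      by (intro exI[of _ "[]"] exI[of _ P]) (simp add: not_Delta_ldvd_one)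
  next
    case False
    then obtain y where y: "lin y ldvd poly_primal P" "\<not> Delta y ldvd poly_primal P"
      unfolding Delta_covered_def eval_at_eq_0_iff by blast
    then obtain h P' where h: "h \<in> motion_points" "primal h = y" "P = lin h * P'" "real_norm P'"
      using real_norm_split less.prems(1) by blast
    note m = monic_lin_mult_iff[of h P', folded h(3), OF less.prems(2)]
    from less.hyps[OF _ h(4) m(1)] m(2) obtain hs R where
      hs: "set hs \<subseteq> motion_points" "P' = prod_list (map lin hs) * R" "leading R = 1"
      "real_norm R" "Delta_covered R" "\<And>z. \<not> Delta z ldvd poly_primal (prod_list (map lin hs))"
      by auto
    \<comment> \<open>A new divisor \<open>Delta z\<close> would have to be \<open>Delta y\<close>,
      and it would divide the primal part of \<open>P\<close>, contrary to the choice of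
      \<open>y\<close>.\<close>
    have "\<not> Delta z ldvd lin y * poly_primal (prod_list (map lin hs))" for z
    proof
      assume *: "Delta z ldvd lin y * poly_primal (prod_list (map lin hs))"
      then have "Delta z = Delta y" using Delta_ldvd_lin_mult hs(6) by blast
      with * have "Delta y ldvd poly_primal P"
        using ldvd_mult_right[of "Delta y" "lin y * poly_primal (prod_list (map lin hs))" "poly_primal R"]
        by (simp add: h(2,3) hs(2) poly_primal_mult mult.assoc)
      with y show False by simp
    qed
    with h hs show ?thesis
      by (intro exI[of _ "h # hs"] exI[of _ R]) (simp add: mult.assoc poly_primal_mult)
  qed
qed

section \<open>Rearranging factors and shifting dual parts\<close>

lemma lin_ldvd_lin_mult_conjugate:
  fixes y z :: quat
  assumes "y \<noteq> z"
  defines "u \<equiv> z - y"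
  shows "lin z ldvd lin y * lin (inverse u * z * u)"
proof -
  have u: "u \<noteq> 0" using assms by simp
  have "lin y = lin z + cst u" by (simp add: lin_eq u_def single_diff)
  moreover have "cst u * lin (inverse u * z * u) = lin z * cst u"
    using u by (simp add: cst_lin[of u _ z] flip: mult.assoc)
  ultimately have "lin y * lin (inverse u * z * u) = lin z * (lin (inverse u * z * u) + cst u)"
    by (simp add: distrib_left distrib_right)
  then show ?thesis by (simp add: ldvd_self_mult)
qed

text \<open>A zero \<open>z\<close> not at the first factor corresponds to a conjugate zero
  \<open>z2\<close> of the tail. By induction the tail can start above \<open>z2\<close>; exchanging
  the first two factors then brings \<open>z\<close> to the front.\<close>

lemma factorization_starting_at_zero:
  assumes "set hs \<subseteq> motion_points" "lin z ldvd poly_primal (prod_list (map lin hs))"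
    and "\<not> Delta z ldvd poly_primal (prod_list (map lin hs))"
  shows "\<exists>k gs. k \<in> motion_points \<and> primal k = z \<and> set gs \<subseteq> motion_points \<and>
    Suc (length gs) = length hs \<and> prod_list (map lin hs) = lin k * prod_list (map lin gs)"
  using assms
proof (induction hs arbitrary: z)
  case Nil
  then show ?case by (simp add: not_lin_ldvd_one)
next
  case (Cons g hs)
  show ?case
  proof (cases "primal g = z")
    case True
    with Cons.prems(1) show ?thesis by (intro exI[of _ g] exI[of _ hs]) simp
  next
    case False
    define u where "u = z - primal g"
    define z2 where "z2 = inverse u * z * u"
    have D: "Delta z2 = Delta z" unfolding z2_def using False by (intro Delta_conjugate) (simp add: u_def)
    have p: "poly_primal (prod_list (map lin (g # hs)))
        = lin (primal g) * poly_primal (prod_list (map lin hs))" by (simp add: poly_primal_mult)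
    have "lin z2 ldvd poly_primal (prod_list (map lin hs))"
      using lin_ldvd_lin_mult[OF _ False] Cons.prems(2) unfolding p z2_def u_def by blast
    moreover have "\<not> Delta z2 ldvd poly_primal (prod_list (map lin hs))"
      using Cons.prems(3) Delta_ldvd_mult unfolding p D by blast
    ultimately obtain k2 gs where k2: "k2 \<in> motion_points" "primal k2 = z2" "set gs \<subseteq> motion_points"
      "Suc (length gs) = length hs" "prod_list (map lin hs) = lin k2 * prod_list (map lin gs)"
      using Cons.IH[of z2] Cons.prems(1) by auto
    define T where "T = lin g * lin k2"
    have pT: "poly_primal T = lin (primal g) * lin z2" by (simp add: T_def poly_primal_mult k2)
    have "lin z ldvd poly_primal T"
      using lin_ldvd_lin_mult_conjugate[OF False] unfolding pT z2_def u_def .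
    moreover have "\<not> Delta z ldvd poly_primal T"
    proof
      assume "Delta z ldvd poly_primal T"
      then have "Delta z ldvd poly_primal T * poly_primal (prod_list (map lin gs))"
        by (rule ldvd_mult_right)
      with Cons.prems(3) show False by (simp add: k2(5) T_def poly_primal_mult mult.assoc)
    qed
    moreover have "real_norm T"
      using Cons.prems(1) k2(1) unfolding T_def by (simp add: real_norm_lin_mult_iff real_norm_lin_iff del: Un_iff)
    ultimately obtain k S where k: "k \<in> motion_points" "primal k = z" "T = lin k * S" "real_norm S"
      using real_norm_split by blast
    have T: "leading T = 1" "deg T = 2"
      using monic_prod_lin[of "1 :: dquat npoly" "[g, k2]"] by (simp_all add: T_def deg_leading_one)
    note m = monic_lin_mult_iff[of k S, folded k(3), OF T(1)]
    \<comment> \<open>The cofactor \<open>S\<close> is monic of degree one, and its real norm puts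
      \<open>g'\<close> among the admissible points.\<close>
    then obtain g' where g': "S = lin g'" using T(2) monic_deg_1[of S] by auto
    have "g' \<in> motion_points" using k(4) unfolding g' real_norm_lin_iff .
    moreover have "prod_list (map lin (g # hs)) = lin k * prod_list (map lin (g' # gs))"
      using k(3) unfolding T_def g' by (simp add: k2(5) flip: mult.assoc)
    ultimately show ?thesis using k k2(3,4) by (intro exI[of _ k] exI[of _ "g' # gs"]) simp
  qed
qed

text \<open>For imaginary \<open>e\<close> the last condition is orthogonality to the imaginary part
  of \<open>y\<close>, so a perpendicular vector in three-space is wanted.\<close>

lemma exists_anticommuting_imaginary:
  fixes y :: quat
  obtains e where "e \<noteq> 0" "e + star e = 0" "y * star e + e * star y = 0"
proof -
  obtain a u1 u2 u3 where y: "y = Quat a u1 u2 u3" by (cases y)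
  show thesis
  proof (cases "u1 = 0 \<and> u2 = 0")
    case True
    then show thesis by (intro that[of "Quat 0 1 0 0"]) (simp_all add: y quat_defs star_quat_def)
  next
    case False
    then show thesis
      by (intro that[of "Quat 0 u2 (- u1) 0"]) (auto simp: y quat_defs star_quat_def)
  qed
qed

text \<open>If the primal parts of two adjacent factors are conjugate, then any imaginary \<open>e\<close> with
  \<open>y e = e (star y)\<close> can be moved from the dual part of one factor to that of the other.\<close>

lemma shift_conjugate_pair:
  fixes r :: real
  assumes h: "h \<in> motion_points" and k: "k \<in> motion_points" and hk: "primal k = star (primal h)"
    and e: "e + star e = 0" "primal h * star e + e * star (primal h) = 0"
  defines "h' \<equiv> DQuat (primal h) (dual h + r *\<^sub>R e)" and "k' \<equiv> DQuat (primal k) (dual k - r *\<^sub>R e)"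
  shows "h' \<in> motion_points" "k' \<in> motion_points" "lin h' * lin k' = lin h * lin k"
proof -
  define y where "y = primal h"
  have star_scale: "star (r *\<^sub>R x) = r *\<^sub>R star x" for x :: quat
    by (simp add: star_quat_def quat_defs)
  have se: "star e = - e" using e(1) by (simp add: eq_neg_iff_add_eq_0 add.commute)
  have ey: "e * star y = y * e" using e(2) by (simp add: se y_def)
  \<comment> \<open>The mirrored relation is what \<open>k'\<close> requires, its primal part being
    \<open>star y\<close>; it follows because \<open>y + star y\<close> is real.\<close>
  have ye: "e * y = star y * e"
  proof -
    obtain s :: real where s: "star y = of_real s - y"
      using add_star_quat[of y] by (metis add_diff_cancel_left')
    have "e * y = e * (of_real s - star y)" by (simp add: s)
    also have "\<dots> = of_real s * e - y * e" by (simp add: right_diff_distrib ey of_real_def)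
    also have "\<dots> = star y * e" by (simp add: s left_diff_distrib)
    finally show ?thesis .
  qed
  show "h' \<in> motion_points"
    using h unfolding mem_linear_set_iff h'_def
    by (simp add: star_add star_scale se ey flip: y_def) (simp add: algebra_simps ey)
  show "k' \<in> motion_points"
    using k unfolding mem_linear_set_iff k'_def hk
    by (simp add: star_diff star_scale se ye flip: y_def) (simp add: algebra_simps ye)
  have "(r *\<^sub>R e) + star (r *\<^sub>R e) = 0" "y * star (r *\<^sub>R e) + (r *\<^sub>R e) * star y = 0"
    by (simp_all add: star_scale se ey)
  note c = linear_factor_condition(1)[OF this]
  show "lin h' * lin k' = lin h * lin k"
    unfolding dquat_poly_eq_iff poly_primal_mult poly_dual_mult
    by (simp add: h'_def k'_def hk single_add single_diff algebra_simps c flip: y_def)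
qed

text \<open>If \<open>Delta z\<close> divides the tail, infinitely many factorizations of the tail
  are prefixed with \<open>h\<close>. Otherwise \<open>Delta z\<close> belongs to the class of the
  first factor, and a conjugate pair is created at the front and shifted.\<close>

lemma infinite_lin_factorizations:
  assumes "set hs \<subseteq> motion_points" "Delta z ldvd poly_primal (prod_list (map lin hs))"
  shows "infinite (lin_factorizations motion_points (length hs) (prod_list (map lin hs)))"
  using assms
proof (induction hs)
  case Nil
  then show ?case by (simp add: not_Delta_ldvd_one)
next
  case (Cons h hs)
  let ?F = "lin_factorizations motion_points (length (h # hs)) (prod_list (map lin (h # hs)))"
  show ?case
  proof (cases "Delta z ldvd poly_primal (prod_list (map lin hs))")
    case True
    with Cons have "infinite (lin_factorizations motion_points (length hs) (prod_list (map lin hs)))"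
      by simp
    then have "infinite ((#) h ` lin_factorizations motion_points (length hs) (prod_list (map lin hs)))"
      by (simp add: finite_image_iff)
    moreover have "(#) h ` lin_factorizations motion_points (length hs) (prod_list (map lin hs)) \<subseteq> ?F"
      using Cons.prems(1) by (auto simp: lin_factorizations_def)
    ultimately show ?thesis using finite_subset by blast
  next
    case False
    define y where "y = primal h"
    have *: "Delta z ldvd lin y * poly_primal (prod_list (map lin hs))"
      using Cons.prems(2) by (simp add: poly_primal_mult y_def)
    with False have D: "Delta z = Delta y" using Delta_ldvd_lin_mult by blast
    \<comment> \<open>Cancelling \<open>lin y\<close> in a multiple of \<open>Delta y\<close>
      exhibits \<open>star y\<close> as a zero of the tail.\<close>
    from * obtain g where "lin y * poly_primal (prod_list (map lin hs)) = lin y * (lin (star y) * g)"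
      unfolding D unfolding ldvd_def Delta_def mult.assoc by blast
    then have "lin (star y) ldvd poly_primal (prod_list (map lin hs))"
      by (simp add: ldvd_self_mult)
    moreover have "\<not> Delta (star y) ldvd poly_primal (prod_list (map lin hs))"
      using False by (simp add: D Delta_star)
    ultimately obtain k gs where k: "k \<in> motion_points" "primal k = star y" "set gs \<subseteq> motion_points"
      "Suc (length gs) = length hs" "prod_list (map lin hs) = lin k * prod_list (map lin gs)"
      using factorization_starting_at_zero[of hs "star y"] Cons.prems(1) by auto
    obtain e where e: "e \<noteq> 0" "e + star e = 0" "y * star e + e * star y = 0"
      using exists_anticommuting_imaginary .
    have h: "h \<in> motion_points" using Cons.prems(1) by simp
    note shift = shift_conjugate_pair[OF h k(1) k(2)[unfolded y_def] e(2) e(3)[unfolded y_def]]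
    \<comment> \<open>All \<open>f r\<close> have the same product, and they are pairwise distinct
      because \<open>e\<close> is nonzero.\<close>
    define f where "f r = DQuat (primal h) (dual h + r *\<^sub>R e) # DQuat (primal k) (dual k - r *\<^sub>R e) # gs"
      for r :: real
    have "inj f" using e(1) by (auto simp: inj_def f_def)
    then have "infinite (range f)" by (simp add: finite_image_iff infinite_UNIV_char_0)
    moreover have "range f \<subseteq> ?F"
    proof
      fix xs assume "xs \<in> range f"
      then obtain r where xs: "xs = f r" by blast
      have "prod_list (map lin xs) = lin h * lin k * prod_list (map lin gs)"
        unfolding xs f_def using shift(3)[of r] by (simp flip: mult.assoc)
      then show "xs \<in> ?F"
        using shift(1,2)[of r] k(3,4) by (simp add: lin_factorizations_def xs f_def k(5) mult.assoc)
    qed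
    ultimately show ?thesis using finite_subset by blast
  qed
qed

lemma poly_primal_embed: "poly_primal (embed p) = p"
  by (rule poly_mapping_eqI) (simp add: embed_def lookup_map_zero zero_dquat_def)

text \<open>Taking primal parts turns a divisor \<open>Delta y\<close> with dual quaternionic
  \<open>y\<close> into the quaternionic divisor \<open>Delta (primal y)\<close>.\<close>

lemma Delta_freeI:
  assumes "\<And>z. \<not> Delta z ldvd poly_primal Q"
  shows "Delta_free Q"
  unfolding Delta_free_def
proof (rule ballI, rule notI)
  fix y assume "Delta y ldvd embed (poly_primal Q)"
  then obtain C where "poly_primal (embed (poly_primal Q)) = poly_primal (Delta y * C)"
    unfolding ldvd_def by auto
  then have "poly_primal Q = Delta (primal y) * poly_primal C"
    by (simp add: poly_primal_embed poly_primal_mult Delta_def)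
  with assms show False unfolding ldvd_def by blast
qed

theorem proposition8p12:
  fixes P :: "dquat npoly" and n :: nat
  assumes "motion_poly P" and "leading P = 1" and "deg P = n" and "n > 0"
  shows "\<exists>Q R q. P = Q * R \<and>
    motion_poly Q \<and> Delta_free Q \<and> deg Q = q \<and> q \<le> n \<and>
    motion_poly R \<and> Delta_covered R \<and>
    finite (lin_factorizations (R_eps_Im \<union> Q_DH) q Q) \<and>
    1 \<le> card (lin_factorizations (R_eps_Im \<union> Q_DH) q Q) \<and>
    card (lin_factorizations (R_eps_Im \<union> Q_DH) q Q) \<le> fact q \<and>
    bij_betw (map primal)
      (lin_factorizations (R_eps_Im \<union> Q_DH) q Q)
      (lin_factorizations UNIV q (poly_primal Q)) \<and>
    (q < n \<longrightarrow>
      infinite (lin_factorizations (R_eps_Im \<union> Q_DH) (n - q) R) \<or>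
      lin_factorizations (R_eps_Im \<union> Q_DH) (n - q) R = {}) \<and>
    (\<forall>hs \<in> lin_factorizations (R_eps_Im \<union> Q_DH) (n - q) R. \<forall>h \<in> set hs.
      Delta (primal h) ldvd poly_primal R)"
proof -
  obtain hs R where hs: "set hs \<subseteq> motion_points" and P: "P = prod_list (map lin hs) * R"
    and R: "leading R = 1" "real_norm R" "Delta_covered R"
    and free: "\<And>z. \<not> Delta z ldvd poly_primal (prod_list (map lin hs))"
    using Delta_free_covered_split assms(1,2) monic_motion_poly_iff by blast
  define Q where "Q = prod_list (map lin hs)"
  define q where "q = length hs"
  have Q: "leading Q = 1" "deg Q = q" "real_norm Q"
    using monic_prod_lin[of "1 :: dquat npoly" hs] real_norm_prod_lin[OF hs, of 1]
    by (simp_all add: Q_def q_def deg_leading_one real_norm_one)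
  have "q \<le> n" using monic_prod_lin(2)[OF R(1), of hs] assms(3) by (simp add: P q_def)
  have bij: "bij_betw (map primal) (lin_factorizations motion_points q Q)
      (lin_factorizations UNIV q (poly_primal Q))"
    using lin_factorizations_primal_bij[OF Q(3,1,2)] free by (simp add: Q_def)
  have bound: "finite (lin_factorizations UNIV q (poly_primal Q))"
    "card (lin_factorizations UNIV q (poly_primal Q)) \<le> fact q"
    using lin_factorizations_UNIV_bound[of "poly_primal Q" q] free by (simp_all add: Q_def)
  have fin: "finite (lin_factorizations motion_points q Q)"
    using bij_betw_finite[OF bij] bound(1) by simp
  have "hs \<in> lin_factorizations motion_points q Q"
    using hs by (simp add: lin_factorizations_def Q_def q_def)
  with fin have one: "1 \<le> card (lin_factorizations motion_points q Q)"
    by (metis One_nat_def Suc_leI card_gt_0_iff empty_iff)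
  have "card (lin_factorizations motion_points q Q) \<le> fact q"
    using bij_betw_same_card[OF bij] bound(2) by simp
  \<comment> \<open>Since \<open>q < n\<close>, a factorization of \<open>R\<close> has a first
    factor; its primal part is a zero, and coveredness supplies the divisor
    \<open>Delta\<close>.\<close>
  have inf: "infinite (lin_factorizations motion_points (n - q) R)"
    if "q < n" "lin_factorizations motion_points (n - q) R \<noteq> {}"
  proof -
    from that(2) obtain ks where ks: "length ks = n - q" "set ks \<subseteq> motion_points" "R = prod_list (map lin ks)"
      unfolding lin_factorizations_def by blast
    with that(1) obtain k ks' where "ks = k # ks'" by (cases ks) auto
    then have "lin (primal k) ldvd poly_primal R"
      by (simp add: ks(3) poly_primal_mult ldvd_self_mult)
    then have "Delta (primal k) ldvd poly_primal R"
      using R(3) unfolding Delta_covered_def eval_at_eq_0_iff by blast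
    then show ?thesis using infinite_lin_factorizations[OF ks(2)] ks by simp
  qed
  \<comment> \<open>The primal part of \<open>k\<close> need not be a zero itself, but its class
    contains a zero \<open>z\<close> with the same \<open>Delta\<close>.\<close>
  have cov: "Delta (primal k) ldvd poly_primal R"
    if ks: "ks \<in> lin_factorizations motion_points (n - q) R" and k: "k \<in> set ks" for k ks
  proof -
    have pR: "poly_primal R = prod_list (map lin (map primal ks))"
      using ks unfolding lin_factorizations_def by (auto simp: poly_primal_prod_lin)
    obtain z where "lin z ldvd poly_primal R" "Delta z = Delta (primal k)"
      using prod_lin_zero_in_class[of "primal k" "map primal ks"] k unfolding pR by auto
    then show ?thesis using R(3) unfolding Delta_covered_def eval_at_eq_0_iff by metis
  qed
  have "P = Q * R" "Delta_free Q" using P free by (simp_all add: Q_def Delta_freeI)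
  moreover have "motion_poly Q" "motion_poly R" using Q R monic_motion_poly_iff by blast+
  moreover note Q(2) \<open>q \<le> n\<close> R(3) fin one \<open>card (lin_factorizations motion_points q Q) \<le> fact q\<close> bij
  ultimately show ?thesis using inf cov by (intro exI[of _ Q] exI[of _ R] exI[of _ q]) blast
qed

end
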